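(* Let $(X,\alpha)$ and $(Y,\beta)$ be Cantor minimal systems and let $\phi:X\to\operatorname{Isom}(\mathbb{T})$ and $\psi:Y\to\operatorname{Isom}(\mathbb{T})$ be continuous maps. Suppose both $\alpha\times\phi$ and $\beta\times\psi$ are orientation preserving. Then the following are equivalent. (1) There exist homeomorphisms $\sigma_n:X\times\mathbb{T}\to Y\times\mathbb{T}$ such that $\sigma_n(\alpha\times\phi)\sigma_n^{-1}$ converges to $\beta\times\psi$ in $\operatorname{Homeo}(Y\times\mathbb{T})$. (2) The periodic spectrum $PS(\beta)$ is contained in the periodic spectrum $PS(\alpha)$.
   Context: A Cantor minimal system $(X,\alpha)$ is a Cantor set $X$ with a homeomorphism $\alpha$ having no nontrivial closed invariant subsets. $\mathbb{T}=\mathbb{R}/\mathbb{Z}$; $R_t(s)=s+t$, $\lambda(s)=-s$, $\operatorname{Isom}(\mathbb{T})=\{R_t\}\cup\{R_t\lambda\}$ with the uniform topology. For compact metrizable $Z$, $\operatorname{Homeo}(Z)$ carries the topology of uniform convergence ($\gamma_n\to\gamma$ iff $\sup_z d(\gamma_n(z),\gamma(z))\to0$). $\alpha\times\phi$ is $(x,t)\mapsto(\alpha(x),\phi_x(t))$. $o(\phi):X\to\mathbb{Z}_2$ is $o(\phi)(x)=0$ if $\phi_x$ preserves orientation and $1$ otherwise. $K^0(X,\alpha)=C(X,\mathbb{Z})/\{f-f\circ\alpha^{-1}\}$ and $K^0(X,\alpha)/2K^0(X,\alpha)$ is identified with $C(X,\mathbb{Z}_2)/\{f-f\circ\alpha^{-1}:f\in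 C(X,\mathbb{Z}_2)\}$; $\alpha\times\phi$ is orientation preserving if the class of $o(\phi)$ there is zero. The periodic spectrum $PS(\alpha)$ of a homeomorphism $\alpha$ of a compact space $X$ is the set of $p\in\mathbb{N}$ for which there is a clopen $U\subset X$ such that $U,\alpha(U),\dots,\alpha^{p-1}(U)$ are pairwise disjoint with union $X$. *)

theory Defs
  imports "HOL-Analysis.Analysis"
begin

text \<open>The circle T = R/Z is modelled as the unit circle in the complex plane,
  via s \<mapsto> exp(2 pi i s).  Under this identification the rotation R_t becomes
  z \<mapsto> c * z with c = exp(2 pi i t) (so cmod c = 1) and the reflection
  s \<mapsto> -s becomes complex conjugation.\<close>

definition circle :: "complex set" where
  "circle = sphere 0 1"

definition isom_T :: "(complex \<Rightarrow> complex) set" where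
  "isom_T = {f. \<exists>c. cmod c = 1 \<and>
      ((\<forall>z\<in>circle. f z = c * z) \<or> (\<forall>z\<in>circle. f z = c * cnj z))}"

definition orientation_preserving_isom :: "(complex \<Rightarrow> complex) \<Rightarrow> bool" where
  "orientation_preserving_isom f \<longleftrightarrow> (\<exists>c. cmod c = 1 \<and> (\<forall>z\<in>circle. f z = c * z))"

definition cantor_set :: "'a::metric_space set \<Rightarrow> bool" where
  "cantor_set X \<longleftrightarrow> X \<noteq> {} \<and> compact X \<and> (\<forall>x\<in>X. x islimpt X)
     \<and> (\<forall>x\<in>X. connected_component_set X x = {x})"

definition homeo_of :: "'a::topological_space set \<Rightarrow> ('a \<Rightarrow> 'a) \<Rightarrow> bool" where
  "homeo_of X f \<longleftrightarrow> homeomorphism X X f (inv_into X f)"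

definition minimal_system :: "'a::topological_space set \<Rightarrow> ('a \<Rightarrow> 'a) \<Rightarrow> bool" where
  "minimal_system X f \<longleftrightarrow> homeo_of X f \<and>
     (\<forall>Z. closedin (top_of_set X) Z \<and> f ` Z = Z \<longrightarrow> Z = {} \<or> Z = X)"

definition cantor_minimal_system :: "'a::metric_space set \<Rightarrow> ('a \<Rightarrow> 'a) \<Rightarrow> bool" where
  "cantor_minimal_system X f \<longleftrightarrow> cantor_set X \<and> minimal_system X f"

definition cont_isom_map :: "'a::metric_space set \<Rightarrow> ('a \<Rightarrow> complex \<Rightarrow> complex) \<Rightarrow> bool" where
  "cont_isom_map X \<phi> \<longleftrightarrow> (\<forall>x\<in>X. \<phi> x \<in> isom_T) \<and>
     (\<forall>x\<in>X. \<forall>e>0. \<exists>d>0. \<forall>y\<in>X. dist y x < d \<longrightarrow> (\<forall>z\<in>circle. dist (\<phi> y z) (\<phi> x z) < e))"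

definition skew :: "('a \<Rightarrow> 'a) \<Rightarrow> ('a \<Rightarrow> complex \<Rightarrow> complex) \<Rightarrow> 'a \<times> complex \<Rightarrow> 'a \<times> complex" where
  "skew \<alpha> \<phi> = (\<lambda>(x, t). (\<alpha> x, \<phi> x t))"

text \<open>o(phi) : X \<rightarrow> Z_2 (values 0/1 as integers).\<close>
definition orient :: "('a \<Rightarrow> complex \<Rightarrow> complex) \<Rightarrow> 'a \<Rightarrow> int" where
  "orient \<phi> x = (if orientation_preserving_isom (\<phi> x) then 0 else 1)"

text \<open>alpha \<times> phi is orientation preserving iff the class of o(phi) in
  K^0(X,alpha)/2K^0(X,alpha) vanishes, i.e.
  o(phi) \<in> {f - f \<circ> alpha^-1 : f \<in> C(X,Z)} + 2 C(X,Z).\<close>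
definition skew_orientation_preserving ::
  "'a::metric_space set \<Rightarrow> ('a \<Rightarrow> 'a) \<Rightarrow> ('a \<Rightarrow> complex \<Rightarrow> complex) \<Rightarrow> bool" where
  "skew_orientation_preserving X \<alpha> \<phi> \<longleftrightarrow>
     (\<exists>f g :: 'a \<Rightarrow> int. continuous_on X f \<and> continuous_on X g \<and>
        (\<forall>x\<in>X. orient \<phi> x = f x - f (inv_into X \<alpha> x) + 2 * g x))"

definition periodic_spectrum :: "'a::topological_space set \<Rightarrow> ('a \<Rightarrow> 'a) \<Rightarrow> nat set" where
  "periodic_spectrum X \<alpha> = {p. 0 < p \<and> (\<exists>U. U \<subseteq> X \<and> openin (top_of_set X) U \<and> closedin (top_of_set X) U
       \<and> pairwise (\<lambda>i j. disjnt ((\<alpha> ^^ i) ` U) ((\<alpha> ^^ j) ` U)) {..<p}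
       \<and> (\<Union>k<p. (\<alpha> ^^ k) ` U) = X)}"

definition unif_conv_on :: "'b::metric_space set \<Rightarrow> (nat \<Rightarrow> 'b \<Rightarrow> 'b) \<Rightarrow> ('b \<Rightarrow> 'b) \<Rightarrow> bool" where
  "unif_conv_on Z g h \<longleftrightarrow> (\<forall>e>0. \<forall>\<^sub>F n in sequentially. \<forall>z\<in>Z. dist (g n z) (h z) < e)"

end

theory Submission
  imports Defs "HOL-Number_Theory.Cong"
begin

text \<open>If \<open>\<sigma> n\<close> conjugates \<open>\<alpha> \<times> \<phi>\<close> close enough to \<open>\<beta> \<times> \<psi>\<close>, a cyclic clopen partition of \<open>Y\<close> pulls
  back along \<open>\<sigma> n\<close> to a cyclic clopen partition of \<open>X \<times> circle\<close>, whose pieces are unions of fibres because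
  the circle is connected.

  Conversely, cut \<open>Y\<close> into fine towers over a small clopen base. The gcd \<open>d\<close> of their heights lies in
  the periodic spectrum of \<open>\<beta>\<close>, hence in that of \<open>\<alpha>\<close>, so \<open>X\<close> has towers whose heights are large multiples
  of \<open>d\<close>; these can be cut into pieces of the heights occurring in \<open>Y\<close>. Matching the pieces by a
  homeomorphism of Cantor sets gives \<open>s\<close> with \<open>s \<circ> \<alpha> \<approx> \<beta> \<circ> s\<close>. The circle direction is no
  obstruction: the orientation hypothesis reduces \<open>\<phi>\<close> and \<open>\<psi>\<close> to rotations, and every continuous
  circle-valued cocycle over a Cantor minimal system is uniformly close to a coboundary.\<close>

section \<open>Locally constant functions\<close>

text \<open>Clopen partitions are not carried along as families of sets: a partition is a function
  satisfying \<open>loc_const\<close>, refining it means pairing labels, and a homeomorphism is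
  controlled only through the labels it preserves. The obstacle is the top of a column: nothing
  determines which column comes next. No exact conjugacy is sought; instead any two points of the
  base in Y are within e, and from a top level both \<beta> \<circ> s and s \<circ> \<alpha> land in
  that base, whatever the order of the columns. For a label-preserving s to exist, the two label
  sets must coincide. So every column of X is filled with columns of Y in such a way that each type
  of column occurs, and its height must be a sum of heights in Y using all of them. Such sums are
  multiples of d, and all large multiples of d are such sums. Divisibility of the return times in X
  comes from a base on which a phase modulo d vanishes, their length from the absence of periodic
  points.\<close>

definition loc_const :: "'a::topological_space set \<Rightarrow> ('a \<Rightarrow> 'b) \<Rightarrow> bool" where
  "loc_const S f \<longleftrightarrow> (\<forall>x\<in>S. \<exists>U. openin (top_of_set S) U \<and> x \<in> U \<and> (\<forall>y\<in>U. f y = f x))"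

lemma loc_constI:
  assumes "\<And>x. x \<in> S \<Longrightarrow> \<exists>U. openin (top_of_set S) U \<and> x \<in> U \<and> (\<forall>y\<in>U. f y = f x)"
  shows "loc_const S f"
  using assms by (auto simp: loc_const_def)

lemma loc_constE:
  assumes "loc_const S f" "x \<in> S"
  obtains U where "openin (top_of_set S) U" "x \<in> U" "U \<subseteq> S" "\<And>y. y \<in> U \<Longrightarrow> f y = f x"
  using assms unfolding loc_const_def by (metis openin_imp_subset)

lemma loc_const_const [simp]: "loc_const S (\<lambda>x. c)"
  by (rule loc_constI) (use openin_subtopology_self in blast)

lemma loc_const_cong:
  assumes "\<And>x. x \<in> S \<Longrightarrow> f x = g x"
  shows "loc_const S f \<longleftrightarrow> loc_const S g"
proof -
  have "loc_const S g" if f: "loc_const S f" and fg: "\<And>x. x \<in> S \<Longrightarrow> f x = g x" for f g :: "'a \<Rightarrow> 'b"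
  proof (rule loc_constI)
    fix x assume x: "x \<in> S"
    obtain U where "openin (top_of_set S) U" "x \<in> U" "U \<subseteq> S" "\<And>y. y \<in> U \<Longrightarrow> f y = f x"
      using loc_constE[OF f x] by metis
    with fg show "\<exists>U. openin (top_of_set S) U \<and> x \<in> U \<and> (\<forall>y\<in>U. g y = g x)"
      by (intro exI[of _ U]) (metis subsetD)
  qed
  with assms show ?thesis by metis
qed

lemma loc_const_comp:
  assumes "loc_const S f"
  shows "loc_const S (\<lambda>x. g (f x))"
  using assms unfolding loc_const_def by metis

lemma loc_const_comp2:
  assumes "loc_const S f" "loc_const S g"
  shows "loc_const S (\<lambda>x. h (f x) (g x))"
proof (rule loc_constI)
  fix x assume x: "x \<in> S"
  obtain U where U: "openin (top_of_set S) U" "x \<in> U" "\<And>y. y \<in> U \<Longrightarrow> f y = f x"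
    using loc_constE[OF assms(1) x] by metis
  obtain V where V: "openin (top_of_set S) V" "x \<in> V" "\<And>y. y \<in> V \<Longrightarrow> g y = g x"
    using loc_constE[OF assms(2) x] by metis
  show "\<exists>W. openin (top_of_set S) W \<and> x \<in> W \<and> (\<forall>y\<in>W. h (f y) (g y) = h (f x) (g x))"
    by (rule exI[of _ "U \<inter> V"]) (metis IntD1 IntD2 IntI U V openin_Int)
qed

lemma loc_const_choose:
  assumes "loc_const S n" "\<And>i. loc_const S (f i)"
  shows "loc_const S (\<lambda>x. f (n x) x)"
proof (rule loc_constI)
  fix x assume x: "x \<in> S"
  obtain U where U: "openin (top_of_set S) U" "x \<in> U" "\<And>y. y \<in> U \<Longrightarrow> n y = n x"
    using loc_constE[OF assms(1) x] by metis
  obtain V where V: "openin (top_of_set S) V" "x \<in> V" "\<And>y. y \<in> V \<Longrightarrow> f (n x) y = f (n x) x"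
    using loc_constE[OF assms(2) x] by metis
  show "\<exists>W. openin (top_of_set S) W \<and> x \<in> W \<and> (\<forall>y\<in>W. f (n y) y = f (n x) x)"
    by (rule exI[of _ "U \<inter> V"]) (metis IntD1 IntD2 IntI U V openin_Int)
qed

lemma loc_const_map:
  assumes "\<And>i. i \<in> set xs \<Longrightarrow> loc_const S (f i)"
  shows "loc_const S (\<lambda>x. map (\<lambda>i. f i x) xs)"
  using assms
proof (induction xs)
  case (Cons i xs)
  then have "loc_const S (f i)" "loc_const S (\<lambda>x. map (\<lambda>i. f i x) xs)" by auto
  from loc_const_comp2[OF this, of Cons] show ?case by simp
qed simp

lemma loc_const_compose:
  assumes "loc_const T f" "continuous_on S g" "g \<in> S \<rightarrow> T"
  shows "loc_const S (\<lambda>x. f (g x))"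
proof (rule loc_constI)
  fix x assume x: "x \<in> S"
  then have "g x \<in> T" using assms(3) by auto
  with assms(1) obtain U where U: "openin (top_of_set T) U" "g x \<in> U" "\<And>y. y \<in> U \<Longrightarrow> f y = f (g x)"
    by (metis loc_constE)
  have "openin (top_of_set S) (S \<inter> g -` U)"
    using continuous_openin_preimage[OF assms(2,3) U(1)] .
  moreover have "x \<in> S \<inter> g -` U" using x U(2) by simp
  moreover have "\<forall>y\<in>S \<inter> g -` U. f (g y) = f (g x)" using U(3) by blast
  ultimately show "\<exists>W. openin (top_of_set S) W \<and> x \<in> W \<and> (\<forall>y\<in>W. f (g y) = f (g x))"
    by blast
qed

text \<open>Whether the least index is \<open>m\<close> is decided by the finitely many predicates
  \<open>P 0\<close>, ..., \<open>P m\<close>, so finitely many neighbourhoods suffice. Entrance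
  times, return times and indices in finite covers become locally constant this way.\<close>

lemma loc_const_Least:
  fixes P :: "nat \<Rightarrow> 'a::topological_space \<Rightarrow> bool"
  assumes "\<And>n. loc_const S (P n)" "\<And>x. x \<in> S \<Longrightarrow> \<exists>n. P n x"
  shows "loc_const S (\<lambda>x. LEAST n. P n x)"
proof (rule loc_constI)
  fix x assume x: "x \<in> S"
  define m where "m = (LEAST n. P n x)"
  have m: "P m x" "\<And>i. i < m \<Longrightarrow> \<not> P i x"
    using assms(2)[OF x] unfolding m_def by (auto intro: LeastI_ex dest: not_less_Least)
  have "loc_const S (\<lambda>y. map (\<lambda>i. P i y) [0..<Suc m])"
    using assms(1) by (rule loc_const_map)
  then obtain U where U: "openin (top_of_set S) U" "x \<in> U"
    "\<And>y. y \<in> U \<Longrightarrow> map (\<lambda>i. P i y) [0..<Suc m] = map (\<lambda>i. P i x) [0..<Suc m]"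
    using x unfolding loc_const_def by meson
  have "(LEAST n. P n y) = m" if "y \<in> U" for y
  proof (rule Least_equality)
    have "P i y = P i x" if "i \<le> m" for i
      using U(3)[OF \<open>y \<in> U\<close>] that by (auto simp: list_eq_iff_nth_eq map_eq_conv simp del: upt_Suc)
    with m show "P m y" "\<And>i. P i y \<Longrightarrow> m \<le> i" by (auto simp: not_less[symmetric])
  qed
  with U(1,2) show "\<exists>U. openin (top_of_set S) U \<and> x \<in> U \<and> (\<forall>y\<in>U. (LEAST n. P n y) = (LEAST n. P n x))"
    by (auto simp: m_def[symmetric])
qed

lemma loc_const_openin:
  assumes "loc_const S f"
  shows "openin (top_of_set S) {x\<in>S. P (f x)}"
proof (subst openin_subopen, intro ballI)
  fix x assume x: "x \<in> {x\<in>S. P (f x)}"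
  then obtain U where "openin (top_of_set S) U" "x \<in> U" "U \<subseteq> S" "\<And>y. y \<in> U \<Longrightarrow> f y = f x"
    using loc_constE[OF assms] by (metis (lifting) mem_Collect_eq)
  with x show "\<exists>T. openin (top_of_set S) T \<and> x \<in> T \<and> T \<subseteq> {x\<in>S. P (f x)}"
    by (intro exI[of _ U]) (metis (mono_tags, lifting) mem_Collect_eq subsetD subsetI)
qed

lemma loc_const_closedin:
  assumes "loc_const S f"
  shows "closedin (top_of_set S) {x\<in>S. P (f x)}"
proof -
  have "S - {x\<in>S. P (f x)} = {x\<in>S. \<not> P (f x)}" by auto
  with loc_const_openin[OF assms, of "\<lambda>v. \<not> P v"] show ?thesis
    by (auto simp: closedin_def)
qed

lemma clopen_imp_loc_const:
  assumes "openin (top_of_set S) U" "closedin (top_of_set S) U"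
  shows "loc_const S (\<lambda>x. x \<in> U)"
proof (rule loc_constI)
  fix x assume x: "x \<in> S"
  have "openin (top_of_set S) (S - U)"
    using assms(2) by (metis closedin_def topspace_euclidean_subtopology)
  with x assms(1) show "\<exists>V. openin (top_of_set S) V \<and> x \<in> V \<and> (\<forall>y\<in>V. (y \<in> U) = (x \<in> U))"
    by (cases "x \<in> U") auto
qed

lemma loc_const_imp_continuous_on:
  fixes f :: "'a::topological_space \<Rightarrow> 'b::topological_space"
  assumes "loc_const S f"
  shows "continuous_on S f"
proof -
  have "S \<inter> f -` B = {x\<in>S. f x \<in> B}" for B by auto
  then show ?thesis
    using loc_const_openin[OF assms] by (auto simp: continuous_on_open_gen[where T=UNIV])
qed

lemma continuous_on_imp_loc_const:
  fixes f :: "'a::topological_space \<Rightarrow> 'b::discrete_topology"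
  assumes "continuous_on S f"
  shows "loc_const S f"
proof (rule loc_constI)
  fix x assume "x \<in> S"
  moreover have "openin (top_of_set S) (S \<inter> f -` {f x})"
    using assms continuous_openin_preimage_gen open_discrete by blast
  ultimately show "\<exists>U. openin (top_of_set S) U \<and> x \<in> U \<and> (\<forall>y\<in>U. f y = f x)"
    by (intro exI[of _ "S \<inter> f -` {f x}"]) auto
qed

text \<open>The radius is a Lebesgue number for the cover of \<open>S\<close> by open sets on which
  \<open>f\<close> is constant.\<close>

lemma loc_const_uniform:
  fixes S :: "'a::metric_space set"
  assumes "compact S" "loc_const S f"
  obtains d where "d > 0" "\<And>x y. x \<in> S \<Longrightarrow> y \<in> S \<Longrightarrow> dist x y < d \<Longrightarrow> f x = f y"
proof -
  define G where "G = {U. open U \<and> (\<forall>x\<in>S\<inter>U. \<forall>y\<in>S\<inter>U. f x = f y)}"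
  have "S \<subseteq> \<Union>G"
  proof
    fix x assume "x \<in> S"
    then obtain U where U: "openin (top_of_set S) U" "x \<in> U" "\<And>y. y \<in> U \<Longrightarrow> f y = f x"
      using assms(2) unfolding loc_const_def by meson
    obtain T where T: "open T" "U = S \<inter> T" using U(1) by (auto simp: openin_open)
    have "f y = f z" if "y \<in> S \<inter> T" "z \<in> S \<inter> T" for y z using U(3) T(2) that by metis
    with T U(2) have "T \<in> G" "x \<in> T" unfolding G_def by blast+
    then show "x \<in> \<Union>G" by auto
  qed
  then obtain e where "0 < e" "\<And>x. x \<in> S \<Longrightarrow> \<exists>U\<in>G. ball x e \<subseteq> U"
    using Heine_Borel_lemma[OF assms(1), of G] unfolding G_def by (metis (lifting) mem_Collect_eq)
  moreover have "f x = f y" if "x \<in> S" "y \<in> S" "dist x y < e" for x y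
  proof -
    obtain U where "U \<in> G" "ball x e \<subseteq> U" using calculation(2)[OF \<open>x \<in> S\<close>] by blast
    with \<open>x \<in> S\<close> \<open>y \<in> S\<close> \<open>dist x y < e\<close> \<open>0 < e\<close> have "x \<in> S \<inter> U" "y \<in> S \<inter> U" by auto
    with \<open>U \<in> G\<close> show ?thesis unfolding G_def by blast
  qed
  ultimately show ?thesis using that by blast
qed

text \<open>The fibres are disjoint, nonempty and open in \<open>S\<close>, so a finite subcover has
  to contain all of them.\<close>

lemma loc_const_finite_range:
  assumes "compact S" "loc_const S f"
  shows "finite (f ` S)"
proof -
  have "openin (top_of_set S) {x\<in>S. f x = v}" for v
    using loc_const_openin[OF assms(2)] .
  then have "\<And>v. \<exists>T. open T \<and> {x\<in>S. f x = v} = S \<inter> T" by (auto simp: openin_open)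
  then obtain T where T: "\<And>v. open (T v)" "\<And>v. {x\<in>S. f x = v} = S \<inter> T v" by metis
  have "S \<subseteq> (\<Union>v\<in>f ` S. T v)"
  proof
    fix x assume "x \<in> S"
    with T(2)[of "f x"] show "x \<in> (\<Union>v\<in>f ` S. T v)" by blast
  qed
  then obtain V where V: "V \<subseteq> f ` S" "finite V" "S \<subseteq> (\<Union>v\<in>V. T v)"
    using compactE_image[OF assms(1)] T(1) by metis
  have "f ` S \<subseteq> V"
  proof
    fix w assume "w \<in> f ` S"
    then obtain x v where "x \<in> S" "w = f x" "v \<in> V" "x \<in> T v" using V(3) by auto
    then have "x \<in> {x\<in>S. f x = v}" using T(2)[of v] by simp
    with \<open>w = f x\<close> \<open>v \<in> V\<close> show "w \<in> V" by simp
  qed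
  with V(2) show ?thesis by (rule finite_subset[rotated])
qed

lemma loc_const_connected:
  assumes "connected S" "loc_const S f" "x \<in> S" "y \<in> S"
  shows "f x = f y"
proof -
  have "{z\<in>S. f z = f y} = {} \<or> {z\<in>S. f z = f y} = S"
    using assms(1) loc_const_openin[OF assms(2), of "\<lambda>v. v = f y"]
      loc_const_closedin[OF assms(2), of "\<lambda>v. v = f y"]
    unfolding connected_clopen by blast
  with assms(3,4) show ?thesis by blast
qed

section \<open>Partitions of Cantor sets\<close>

text \<open>In a compact Hausdorff space a component can be separated by a clopen set from any
  closed set disjoint from it; here the component is \<open>{x}\<close> and the closed set is the
  part of \<open>X\<close> outside the ball.\<close>

lemma cantor_set_clopen_nbhd:
  fixes X :: "'a::metric_space set"
  assumes "cantor_set X" "x \<in> X" "e > 0"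
  obtains K where "openin (top_of_set X) K" "closedin (top_of_set X) K" "x \<in> K" "K \<subseteq> ball x e"
proof -
  let ?X = "top_of_set X"
  have X: "compact X" "connected_component_set X x = {x}"
    using assms by (auto simp: cantor_set_def)
  have "Hausdorff_space ?X" by (simp add: Hausdorff_space_subtopology)
  moreover have "compact_space ?X" using X(1) by (simp add: compact_space_subtopology)
  moreover have "{x} \<in> connected_components_of ?X"
  proof -
    have "connected_component_of_set ?X x = connected_component_set X x"
      unfolding connected_component_of_def connected_component_def
      by (auto simp: connectedin_subtopology)
    with X(2) have "{x} = connected_component_of_set ?X x" by simp
    with assms(2) show ?thesis unfolding connected_components_of_def by auto
  qed
  moreover have "closedin ?X (X - ball x e)"
    by (metis closedin_def Diff_Diff_Int Diff_subset Int_commute openin_open_Int open_ball topspace_euclidean_subtopology)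
  ultimately have "separated_between ?X {x} (X - ball x e)"
    using assms(2,3) compact_imp_locally_compact_space
    by (intro separated_between_compact_connected_component) (auto simp: disjnt_def)
  then obtain U V where "openin ?X U" "openin ?X V" "U \<union> V = X" "disjnt U V" "x \<in> U" "X - ball x e \<subseteq> V"
    unfolding separated_between_def by auto
  moreover from this have "X - U = V" by (auto simp: disjnt_def)
  then have "closedin ?X U" using \<open>openin ?X V\<close> \<open>U \<union> V = X\<close> by (auto simp: closedin_def)
  ultimately show ?thesis by (intro that[of U]) (auto simp: disjnt_def)
qed

text \<open>Finitely many small clopen sets cover \<open>X\<close>. Labelling a point by the first
  of them that contains it turns the cover into a partition.\<close>

lemma cantor_set_fine_labels:
  fixes X :: "'a::metric_space set"
  assumes "cantor_set X" "e > 0"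
  obtains c :: "'a \<Rightarrow> nat" where "loc_const X c"
    "\<And>x y. x \<in> X \<Longrightarrow> y \<in> X \<Longrightarrow> c x = c y \<Longrightarrow> dist x y < e"
proof -
  have "\<exists>K. openin (top_of_set X) K \<and> closedin (top_of_set X) K \<and> x \<in> K \<and> K \<subseteq> ball x (e/2)"
    if "x \<in> X" for x
    using cantor_set_clopen_nbhd[OF assms(1) that, of "e/2"] assms(2) by (metis half_gt_zero)
  then obtain K where K: "\<And>x. x \<in> X \<Longrightarrow> openin (top_of_set X) (K x)"
    "\<And>x. x \<in> X \<Longrightarrow> closedin (top_of_set X) (K x)" "\<And>x. x \<in> X \<Longrightarrow> x \<in> K x"
    "\<And>x. x \<in> X \<Longrightarrow> K x \<subseteq> ball x (e/2)"
    by metis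
  have "\<exists>T. x \<in> X \<longrightarrow> open T \<and> K x = X \<inter> T" for x
    using K(1) by (auto simp: openin_open)
  then obtain T where T: "\<And>x. x \<in> X \<Longrightarrow> open (T x)" "\<And>x. x \<in> X \<Longrightarrow> K x = X \<inter> T x" by metis
  have "compact X" using assms(1) by (simp add: cantor_set_def)
  moreover have "X \<subseteq> (\<Union>x\<in>X. T x)" using K(3) T(2) by auto
  ultimately obtain D where D: "D \<subseteq> X" "finite D" "X \<subseteq> (\<Union>x\<in>D. T x)"
    using T(1) by (metis compactE_image)
  obtain xs where xs: "set xs = D" using finite_list D(2) by auto
  define P where "P i x \<longleftrightarrow> i < length xs \<and> x \<in> K (xs ! i)" for i x
  have ex: "\<exists>i. P i x" if "x \<in> X" for x
  proof -
    obtain d where "d \<in> D" "x \<in> T d" using D(3) \<open>x \<in> X\<close> by blast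
    with D(1) T(2) \<open>x \<in> X\<close> have "x \<in> K d" by auto
    with \<open>d \<in> D\<close> show ?thesis unfolding P_def by (metis in_set_conv_nth xs)
  qed
  have "loc_const X (P i)" for i
  proof (cases "i < length xs")
    case True
    then have "xs ! i \<in> X" using xs D by auto
    then have "loc_const X (\<lambda>x. x \<in> K (xs ! i))" using K(1,2) by (intro clopen_imp_loc_const)
    then show ?thesis using True by (simp add: P_def[abs_def])
  qed (simp add: P_def[abs_def])
  then have "loc_const X (\<lambda>x. LEAST i. P i x)" using ex by (intro loc_const_Least)
  moreover have "dist x y < e" if "x \<in> X" "y \<in> X" "(LEAST i. P i x) = (LEAST i. P i y)" for x y
  proof -
    define i where "i = (LEAST i. P i x)"
    have i: "P i x" "P i y" using LeastI_ex[OF ex] that unfolding i_def by metis+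
    then have "xs ! i \<in> X" using xs D by (auto simp: P_def)
    with i K(4) have "dist (xs ! i) x < e/2" "dist (xs ! i) y < e/2"
      unfolding P_def by (meson mem_ball subsetD)+
    then show ?thesis using dist_triangle_half_r by metis
  qed
  ultimately show ?thesis by (rule that)
qed

text \<open>A nonempty open subset of a Cantor set is infinite, hence splits into any prescribed
  finite number of nonempty relatively clopen pieces. They grow around \<open>card S\<close> points
  of \<open>K\<close>, kept apart by labels finer than their mutual distances.\<close>

lemma cantor_set_onto_labels:
  fixes X :: "'a::metric_space set" and S :: "'s set"
  assumes "cantor_set X" "openin (top_of_set X) K" "K \<noteq> {}" "finite S" "S \<noteq> {}"
  obtains e where "loc_const X e" "e ` K = S"
proof -
  obtain x T where x: "x \<in> K" "open T" "K = X \<inter> T" using assms(2,3) by (auto simp: openin_open)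
  then have "x islimpt X" "open T" "x \<in> T" using assms(1) by (auto simp: cantor_set_def)
  then have "x islimpt K" using x(3)
    by (metis islimpt_Int_eventually eventually_at_in_open' eventually_at_topological)
  then have "infinite K" using islimpt_finite by blast
  then obtain F where F: "F \<subseteq> K" "finite F" "card F = card S"
    by (metis infinite_arbitrarily_large)
  then obtain g where g: "bij_betw g F S" using assms(4) by (metis finite_same_card_bij)
  obtain s0 where "s0 \<in> S" using assms(5) by auto
  obtain \<delta> where \<delta>: "\<And>p. \<delta> p > 0" "\<And>p q. q \<in> F \<Longrightarrow> q \<noteq> p \<Longrightarrow> \<delta> p \<le> dist p q"
    using finite_set_avoid[OF F(2)] by metis
  define d where "d = Min (insert 1 (\<delta> ` F))"
  have d: "d > 0" "\<And>p q. p \<in> F \<Longrightarrow> q \<in> F \<Longrightarrow> p \<noteq> q \<Longrightarrow> d \<le> dist p q"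
    using F(2) \<delta> unfolding d_def
    by (auto intro: Min.coboundedI[THEN order_trans])
  obtain c :: "'a \<Rightarrow> nat" where c: "loc_const X c" "\<And>x y. x \<in> X \<Longrightarrow> y \<in> X \<Longrightarrow> c x = c y \<Longrightarrow> dist x y < d"
    using cantor_set_fine_labels[OF assms(1) d(1)] by metis
  have FX: "F \<subseteq> X" using F x by auto
  have inj: "inj_on c F"
  proof (rule inj_onI)
    fix p q assume "p \<in> F" "q \<in> F" "c p = c q"
    then show "p = q" using c(2)[of p q] d(2)[of p q] FX by fastforce
  qed
  \<comment> \<open>Classes of \<open>c\<close> that contain no chosen point receive the default
    \<open>s0\<close>, so no value outside \<open>S\<close> arises.\<close>
  define e where "e y = (if c y \<in> c ` F then g (inv_into F c (c y)) else s0)" for y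
  have "loc_const X e" unfolding e_def using c(1) by (rule loc_const_comp)
  moreover have "e p = g p" if "p \<in> F" for p using that inj by (auto simp: e_def)
  then have "S \<subseteq> e ` K" using g F(1) unfolding bij_betw_def by force
  moreover have "e y \<in> S" for y
    unfolding e_def using g \<open>s0 \<in> S\<close> by (auto simp: bij_betw_def intro: inv_into_into)
  ultimately show ?thesis by (intro that[of e]) auto
qed

text \<open>The finite intersection property for label conditions: if every point failed one of
  them, the first failing index would be locally constant, hence bounded by some \<open>M\<close>,
  against a point that meets all conditions up to \<open>M\<close>.\<close>

lemma loc_const_compactness:
  assumes "compact S" "\<And>n::nat. loc_const S (f n)" "\<And>n. \<exists>y\<in>S. \<forall>i\<le>n. f i y = v i"
  obtains y where "y \<in> S" "\<And>i. f i y = v i"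
proof (rule ccontr)
  assume "\<not> thesis"
  with that have ex: "\<exists>i. f i y \<noteq> v i" if "y \<in> S" for y using \<open>y \<in> S\<close> by blast
  define g where "g y = (LEAST i. f i y \<noteq> v i)" for y
  have "loc_const S g"
    unfolding g_def using loc_const_comp[OF assms(2)] ex by (intro loc_const_Least)
  then have "finite (g ` S)" using assms(1) by (intro loc_const_finite_range)
  then obtain M where M: "\<And>y. y \<in> S \<Longrightarrow> g y \<le> M"
    unfolding finite_nat_set_iff_bounded_le by blast
  obtain y where y: "y \<in> S" "\<forall>i\<le>M. f i y = v i" using assms(3) by blast
  have "f (g y) y \<noteq> v (g y)" unfolding g_def using ex[OF y(1)] by (rule LeastI_ex)
  with y M show False by blast
qed

text \<open>Only \<open>X\<close> is made fine. Each class of \<open>Y\<close> is cut into as many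
  pieces as \<open>c\<close> has values on the class of \<open>X\<close> with the same label, which
  keeps the label sets equal. The map \<open>t\<close> forgets the new component.\<close>

lemma refine_labels_half:
  fixes X :: "'a::metric_space set" and Y :: "'b::metric_space set"
    and \<rho> :: "'a \<Rightarrow> nat" and \<pi> :: "'b \<Rightarrow> nat"
  assumes "cantor_set X" "cantor_set Y" "loc_const X \<rho>" "loc_const Y \<pi>" "\<rho> ` X = \<pi> ` Y" "e > 0"
  obtains \<rho>' :: "'a \<Rightarrow> nat" and \<pi>' :: "'b \<Rightarrow> nat" and t
  where "loc_const X \<rho>'" "loc_const Y \<pi>'" "\<rho>' ` X = \<pi>' ` Y"
    "\<And>x. \<rho> x = t (\<rho>' x)" "\<And>y. \<pi> y = t (\<pi>' y)"
    "\<And>x y. x \<in> X \<Longrightarrow> y \<in> X \<Longrightarrow> \<rho>' x = \<rho>' y \<Longrightarrow> dist x y < e"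
proof -
  obtain c :: "'a \<Rightarrow> nat" where c: "loc_const X c" "\<And>x y. x \<in> X \<Longrightarrow> y \<in> X \<Longrightarrow> c x = c y \<Longrightarrow> dist x y < e"
    using cantor_set_fine_labels[OF assms(1,6)] by metis
  have "compact X" using assms(1) by (simp add: cantor_set_def)
  then have fin: "finite (c ` X)" using c(1) by (rule loc_const_finite_range)
  have "\<exists>g. loc_const Y g \<and> (l \<in> \<pi> ` Y \<longrightarrow> g ` {y\<in>Y. \<pi> y = l} = c ` {x\<in>X. \<rho> x = l})" for l
  proof (cases "l \<in> \<pi> ` Y")
    case True
    have 1: "openin (top_of_set Y) {y\<in>Y. \<pi> y = l}" using assms(4) by (rule loc_const_openin)
    have 2: "{y\<in>Y. \<pi> y = l} \<noteq> {}" using True by auto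
    have 3: "finite (c ` {x\<in>X. \<rho> x = l})" using fin by (rule rev_finite_subset) auto
    have "l \<in> \<rho> ` X" using True assms(5) by simp
    then have 4: "c ` {x\<in>X. \<rho> x = l} \<noteq> {}" by auto
    show ?thesis using cantor_set_onto_labels[OF assms(2) 1 2 3 4] by metis
  next
    case False
    then show ?thesis by (intro exI[of _ "\<lambda>_. 0"]) simp
  qed
  then obtain g where g: "\<And>l. loc_const Y (g l)"
    "\<And>l. l \<in> \<pi> ` Y \<Longrightarrow> g l ` {y\<in>Y. \<pi> y = l} = c ` {x\<in>X. \<rho> x = l}"
    by metis
  define \<rho>' where "\<rho>' x = prod_encode (\<rho> x, c x)" for x
  define \<pi>' where "\<pi>' y = prod_encode (\<pi> y, g (\<pi> y) y)" for y
  have "loc_const X \<rho>'"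
    unfolding \<rho>'_def using loc_const_comp2[OF assms(3) c(1)] .
  moreover have "loc_const Y (\<lambda>y. g (\<pi> y) y)" using assms(4) g(1) by (rule loc_const_choose)
  then have "loc_const Y \<pi>'"
    unfolding \<pi>'_def by (rule loc_const_comp2[OF assms(4)])
  moreover have "\<rho>' ` X = \<pi>' ` Y"
  proof (intro equalityI subsetI)
    fix v assume "v \<in> \<rho>' ` X"
    then obtain x where x: "x \<in> X" "v = \<rho>' x" by auto
    then have "c x \<in> g (\<rho> x) ` {y\<in>Y. \<pi> y = \<rho> x}" using g(2)[of "\<rho> x"] assms(5) by auto
    then obtain y where "y \<in> Y" "\<pi> y = \<rho> x" "c x = g (\<rho> x) y" by blast
    then have "y \<in> Y" "v = \<pi>' y" using x(2) by (simp_all add: \<rho>'_def \<pi>'_def)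
    then show "v \<in> \<pi>' ` Y" by blast
  next
    fix v assume "v \<in> \<pi>' ` Y"
    then obtain y where y: "y \<in> Y" "v = \<pi>' y" by auto
    then have "g (\<pi> y) y \<in> c ` {x\<in>X. \<rho> x = \<pi> y}" using g(2)[of "\<pi> y"] by auto
    then obtain x where "x \<in> X" "\<rho> x = \<pi> y" "g (\<pi> y) y = c x" by blast
    then have "x \<in> X" "v = \<rho>' x" using y(2) by (simp_all add: \<rho>'_def \<pi>'_def)
    then show "v \<in> \<rho>' ` X" by blast
  qed
  moreover have "\<rho> x = fst (prod_decode (\<rho>' x))" "\<pi> y = fst (prod_decode (\<pi>' y))" for x y
    by (simp_all add: \<rho>'_def \<pi>'_def)
  moreover have "dist x y < e" if "x \<in> X" "y \<in> X" "\<rho>' x = \<rho>' y" for x y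
    using that c(2) by (auto simp: \<rho>'_def)
  ultimately show ?thesis by (rule that)
qed

text \<open>The half step is used twice, the second time with \<open>X\<close> and \<open>Y\<close>
  exchanged; refining the labels of \<open>X\<close> further keeps the smallness already gained
  there.\<close>

lemma refine_labels:
  fixes X :: "'a::metric_space set" and Y :: "'b::metric_space set"
    and \<rho> :: "'a \<Rightarrow> nat" and \<pi> :: "'b \<Rightarrow> nat"
  assumes "cantor_set X" "cantor_set Y" "loc_const X \<rho>" "loc_const Y \<pi>" "\<rho> ` X = \<pi> ` Y" "e > 0"
  obtains \<rho>' :: "'a \<Rightarrow> nat" and \<pi>' :: "'b \<Rightarrow> nat" and t
  where "loc_const X \<rho>'" "loc_const Y \<pi>'" "\<rho>' ` X = \<pi>' ` Y"
    "\<And>x. \<rho> x = t (\<rho>' x)" "\<And>y. \<pi> y = t (\<pi>' y)"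
    "\<And>x y. x \<in> X \<Longrightarrow> y \<in> X \<Longrightarrow> \<rho>' x = \<rho>' y \<Longrightarrow> dist x y < e"
    "\<And>x y. x \<in> Y \<Longrightarrow> y \<in> Y \<Longrightarrow> \<pi>' x = \<pi>' y \<Longrightarrow> dist x y < e"
proof -
  obtain \<rho>1 :: "'a \<Rightarrow> nat" and \<pi>1 :: "'b \<Rightarrow> nat" and t1 where 1: "loc_const X \<rho>1" "loc_const Y \<pi>1" "\<rho>1 ` X = \<pi>1 ` Y"
    "\<And>x. \<rho> x = t1 (\<rho>1 x)" "\<And>y. \<pi> y = t1 (\<pi>1 y)"
    "\<And>x y. x \<in> X \<Longrightarrow> y \<in> X \<Longrightarrow> \<rho>1 x = \<rho>1 y \<Longrightarrow> dist x y < e"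
    using refine_labels_half[OF assms] by blast
  obtain \<rho>2 :: "'a \<Rightarrow> nat" and \<pi>2 :: "'b \<Rightarrow> nat" and t2 where 2: "loc_const Y \<pi>2" "loc_const X \<rho>2" "\<pi>2 ` Y = \<rho>2 ` X"
    "\<And>y. \<pi>1 y = t2 (\<pi>2 y)" "\<And>x. \<rho>1 x = t2 (\<rho>2 x)"
    "\<And>x y. x \<in> Y \<Longrightarrow> y \<in> Y \<Longrightarrow> \<pi>2 x = \<pi>2 y \<Longrightarrow> dist x y < e"
    using refine_labels_half[OF assms(2,1) 1(2,1) 1(3)[symmetric] assms(6)] by blast
  have "dist x y < e" if "x \<in> X" "y \<in> X" "\<rho>2 x = \<rho>2 y" for x y
    using that 1(6) 2(5) by metis
  moreover have "\<rho> x = (t1 \<circ> t2) (\<rho>2 x)" "\<pi> y = (t1 \<circ> t2) (\<pi>2 y)" for x y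
    using 1(4,5) 2(4,5) by (metis comp_apply)+
  ultimately show ?thesis using 2(1,2,6) 2(3)[symmetric] by (intro that)
qed

text \<open>Brouwer's uniqueness theorem for the Cantor set: \<open>s x\<close> is the point of \<open>Y\<close> that carries the
  labels of \<open>x\<close> in a sequence of ever finer partitions refined alternately on both sides.\<close>

theorem cantor_sets_homeomorphic_labels:
  fixes X :: "'a::metric_space set" and Y :: "'b::metric_space set"
    and \<rho> :: "'a \<Rightarrow> 'l::countable" and \<pi> :: "'b \<Rightarrow> 'l"
  assumes X: "cantor_set X" and Y: "cantor_set Y"
    and "loc_const X \<rho>" "loc_const Y \<pi>" "\<rho> ` X = \<pi> ` Y"
  obtains s s' where "homeomorphism X Y s s'" "\<And>x. x \<in> X \<Longrightarrow> \<pi> (s x) = \<rho> x"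
proof -
  \<comment> \<open>The clause for \<open>n = 0\<close> starts the sequence at the given labels,
    which is what makes \<open>s\<close> match \<open>\<rho>\<close> with \<open>\<pi>\<close>. The
    guard \<open>n > 0\<close> is there because \<open>1 / real 0\<close> is 0.\<close>
  define P where "P n p \<longleftrightarrow> loc_const X (fst p) \<and> loc_const Y (snd p) \<and> fst p ` X = snd p ` Y \<and>
     (\<forall>x\<in>X. \<forall>y\<in>X. n > 0 \<longrightarrow> fst p x = fst p y \<longrightarrow> dist x y < 1 / real n) \<and>
     (\<forall>x\<in>Y. \<forall>y\<in>Y. n > 0 \<longrightarrow> snd p x = snd p y \<longrightarrow> dist x y < 1 / real n) \<and>
     (n = 0 \<longrightarrow> fst p = to_nat \<circ> \<rho> \<and> snd p = to_nat \<circ> \<pi>)"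
    for n and p :: "('a \<Rightarrow> nat) \<times> ('b \<Rightarrow> nat)"
  define Q where "Q n p p' \<longleftrightarrow> (\<exists>t. (\<forall>x. fst p x = t (fst p' x)) \<and> (\<forall>y. snd p y = t (snd p' y)))"
    for n :: nat and p p' :: "('a \<Rightarrow> nat) \<times> ('b \<Rightarrow> nat)"
  have "\<exists>f. \<forall>n. P n (f n) \<and> Q n (f n) (f (Suc n))"
  proof (rule dependent_nat_choice)
    have "P 0 (to_nat \<circ> \<rho>, to_nat \<circ> \<pi>)"
    proof -
      have "(to_nat \<circ> \<rho>) ` X = (to_nat \<circ> \<pi>) ` Y" using assms(5) by (metis image_comp)
      then show ?thesis
        unfolding P_def using loc_const_comp[OF assms(3), of to_nat] loc_const_comp[OF assms(4), of to_nat]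
        by (simp add: comp_def)
    qed
    then show "\<exists>p. P 0 p" by blast
  next
    fix p n assume "P n p"
    then have p: "loc_const X (fst p)" "loc_const Y (snd p)" "fst p ` X = snd p ` Y"
      unfolding P_def by blast+
    have pos: "1 / real (Suc n) > 0" by simp
    obtain \<rho>' :: "'a \<Rightarrow> nat" and \<pi>' :: "'b \<Rightarrow> nat" and t where
      "loc_const X \<rho>'" "loc_const Y \<pi>'" "\<rho>' ` X = \<pi>' ` Y"
      "\<And>x. fst p x = t (\<rho>' x)" "\<And>y. snd p y = t (\<pi>' y)"
      "\<And>x y. x \<in> X \<Longrightarrow> y \<in> X \<Longrightarrow> \<rho>' x = \<rho>' y \<Longrightarrow> dist x y < 1 / real (Suc n)"
      "\<And>x y. x \<in> Y \<Longrightarrow> y \<in> Y \<Longrightarrow> \<pi>' x = \<pi>' y \<Longrightarrow> dist x y < 1 / real (Suc n)"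
      using refine_labels[OF X Y p pos] by blast
    then have "P (Suc n) (\<rho>', \<pi>')" "Q n p (\<rho>', \<pi>')" unfolding P_def Q_def by auto
    then show "\<exists>p'. P (Suc n) p' \<and> Q n p p'" by blast
  qed
  then obtain f where f: "\<And>n. P n (f n)" "\<And>n. Q n (f n) (f (Suc n))" by blast
  define r where "r n = fst (f n)" for n
  define q where "q n = snd (f n)" for n
  have lc: "loc_const X (r n)" "loc_const Y (q n)" "r n ` X = q n ` Y" for n
    using f(1)[of n] by (auto simp: P_def r_def q_def)
  have small: "x \<in> X \<Longrightarrow> y \<in> X \<Longrightarrow> r (Suc n) x = r (Suc n) y \<Longrightarrow> dist x y < 1 / real (Suc n)"
     "u \<in> Y \<Longrightarrow> v \<in> Y \<Longrightarrow> q (Suc n) u = q (Suc n) v \<Longrightarrow> dist u v < 1 / real (Suc n)" for x y u v n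
    using f(1)[of "Suc n"] by (auto simp: P_def r_def q_def)
  have zero: "r 0 = to_nat \<circ> \<rho>" "q 0 = to_nat \<circ> \<pi>"
    using f(1)[of 0] by (auto simp: P_def r_def q_def)
  \<comment> \<open>Coarse labels are obtained from finer ones by the same \<open>t\<close> on both
    sides, so agreement at one stage passes down to all earlier stages.\<close>
  have step: "r (Suc n) x = q (Suc n) y \<Longrightarrow> r n x = q n y" for n x y
    using f(2)[of n] unfolding Q_def r_def q_def by metis
  have down: "r i x = q i y" if "r n x = q n y" "i \<le> n" for n i x y
    using that(2,1) by (induction rule: inc_induct) (auto intro: step)
  have cpt: "compact X" "compact Y" using X Y by (auto simp: cantor_set_def)
  have "\<exists>y\<in>Y. \<forall>i. q i y = r i x" if "x \<in> X" for x
  proof -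
    have "\<exists>y\<in>Y. \<forall>i\<le>n. q i y = r i x" for n
    proof -
      obtain y where "y \<in> Y" "r n x = q n y" using lc(3)[of n] \<open>x \<in> X\<close> by blast
      then show ?thesis using down[of n x y] by (intro bexI[of _ y]) auto
    qed
    from loc_const_compactness[OF cpt(2) lc(2) this] show ?thesis by blast
  qed
  then obtain s where s: "\<And>x. x \<in> X \<Longrightarrow> s x \<in> Y" "\<And>x i. x \<in> X \<Longrightarrow> q i (s x) = r i x" by metis
  have onto: "\<exists>x\<in>X. \<forall>i. r i x = q i y" if "y \<in> Y" for y
  proof -
    have "\<exists>x\<in>X. \<forall>i\<le>n. r i x = q i y" for n
    proof -
      obtain x where "x \<in> X" "r n x = q n y"
        using lc(3)[of n] \<open>y \<in> Y\<close> by (metis imageE imageI)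
      then show ?thesis using down[of n x y] by (intro bexI[of _ x]) auto
    qed
    from loc_const_compactness[OF cpt(1) lc(1) this] show ?thesis by blast
  qed
  have eq0: "u = v" if "\<And>n. dist u v < 1 / real (Suc n)" for u v :: "'c::metric_space"
    using that by (metis dist_eq_0_iff linorder_not_less nat_approx_posE order_less_asym zero_le_dist order_less_le)
  have eqX: "x = y" if "x \<in> X" "y \<in> X" "\<And>i. r i x = r i y" for x y
    using that small(1) by (intro eq0) blast
  have eqY: "x = y" if "x \<in> Y" "y \<in> Y" "\<And>i. q i x = q i y" for x y
    using that small(2) by (intro eq0) blast
  have "inj_on s X"
    by (rule inj_onI) (metis eqX s(2))
  moreover have "s ` X = Y"
  proof
    show "Y \<subseteq> s ` X"
    proof
      fix y assume y: "y \<in> Y"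
      then obtain x where "x \<in> X" "\<forall>i. r i x = q i y" using onto by blast
      then have "y = s x" using s y by (intro eqY) auto
      with \<open>x \<in> X\<close> show "y \<in> s ` X" by blast
    qed
  qed (use s in auto)
  moreover have "continuous_on X s"
    unfolding continuous_on_iff
  proof (intro ballI allI impI)
    fix x and e :: real assume x: "x \<in> X" and "0 < e"
    then obtain n where n: "1 / real (Suc n) < e" using nat_approx_posE by blast
    obtain d where d: "d > 0" "\<And>x y. x \<in> X \<Longrightarrow> y \<in> X \<Longrightarrow> dist x y < d \<Longrightarrow> r (Suc n) x = r (Suc n) y"
      using loc_const_uniform[OF cpt(1) lc(1)] by metis
    have "dist (s x') (s x) < e" if "x' \<in> X" "dist x' x < d" for x'
    proof -
      have "q (Suc n) (s x') = q (Suc n) (s x)" using d(2)[OF that(1) x that(2)] s(2) that(1) x by metis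
      then have "dist (s x') (s x) < 1 / real (Suc n)" using small(2) s(1) that(1) x by blast
      with n show ?thesis by linarith
    qed
    with d(1) show "\<exists>d>0. \<forall>x'\<in>X. dist x' x < d \<longrightarrow> dist (s x') (s x) < e" by blast
  qed
  ultimately obtain s' where "homeomorphism X Y s s'"
    using homeomorphism_compact[OF cpt(1)] by metis
  moreover have "\<pi> (s x) = \<rho> x" if "x \<in> X" for x
    using s(2)[OF that, of 0] by (simp add: zero)
  ultimately show ?thesis by (rule that)
qed

section \<open>Cantor minimal systems\<close>

locale cantor_minimal =
  fixes X :: "'a::metric_space set" and \<alpha> :: "'a \<Rightarrow> 'a"
  assumes cms: "cantor_minimal_system X \<alpha>"
begin

abbreviation \<alpha>' :: "'a \<Rightarrow> 'a" where "\<alpha>' \<equiv> inv_into X \<alpha>"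

lemma cantor: "cantor_set X" and compact_X: "compact X" and X_nonempty: "X \<noteq> {}"
  using cms by (auto simp: cantor_minimal_system_def cantor_set_def)

lemma homeo: "homeomorphism X X \<alpha> \<alpha>'"
  using cms by (auto simp: cantor_minimal_system_def minimal_system_def homeo_of_def)

lemma minimal: "closedin (top_of_set X) Z \<Longrightarrow> \<alpha> ` Z = Z \<Longrightarrow> Z = {} \<or> Z = X"
  using cms by (auto simp: cantor_minimal_system_def minimal_system_def)

lemma in_X [simp]: "x \<in> X \<Longrightarrow> \<alpha> x \<in> X" "x \<in> X \<Longrightarrow> \<alpha>' x \<in> X"
  using homeo by (auto simp: homeomorphism_def)

lemma inverse_in_X [simp]: "x \<in> X \<Longrightarrow> \<alpha>' (\<alpha> x) = x" "x \<in> X \<Longrightarrow> \<alpha> (\<alpha>' x) = x"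
  using homeo by (auto simp: homeomorphism_def)

lemma pow_in_X [simp]: "x \<in> X \<Longrightarrow> (\<alpha> ^^ n) x \<in> X" "x \<in> X \<Longrightarrow> (\<alpha>' ^^ n) x \<in> X"
  by (induction n) auto

lemma pow_inverse [simp]:
  "x \<in> X \<Longrightarrow> (\<alpha>' ^^ n) ((\<alpha> ^^ n) x) = x" "x \<in> X \<Longrightarrow> (\<alpha> ^^ n) ((\<alpha>' ^^ n) x) = x"
  by (induction n arbitrary: x) (simp_all add: funpow_swap1 del: funpow.simps, simp_all add: funpow_swap1)

lemma pow_back_forth:
  assumes "x \<in> X" "i \<le> j"
  shows "(\<alpha>' ^^ i) ((\<alpha> ^^ j) x) = (\<alpha> ^^ (j - i)) x" "(\<alpha> ^^ i) ((\<alpha>' ^^ j) x) = (\<alpha>' ^^ (j - i)) x"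
proof -
  have "(\<alpha> ^^ j) x = (\<alpha> ^^ i) ((\<alpha> ^^ (j - i)) x)" "(\<alpha>' ^^ j) x = (\<alpha>' ^^ i) ((\<alpha>' ^^ (j - i)) x)"
    using assms(2) by (metis comp_apply funpow_add le_add_diff_inverse)+
  with assms(1) show "(\<alpha>' ^^ i) ((\<alpha> ^^ j) x) = (\<alpha> ^^ (j - i)) x"
     "(\<alpha> ^^ i) ((\<alpha>' ^^ j) x) = (\<alpha>' ^^ (j - i)) x" by simp_all
qed

lemma continuous_pow: "continuous_on X (\<alpha> ^^ n)" "continuous_on X (\<alpha>' ^^ n)"
proof -
  have "continuous_on X \<alpha>" "continuous_on X \<alpha>'" using homeo by (auto simp: homeomorphism_def)
  then have "continuous_on X (\<lambda>x. (\<alpha> ^^ n) x) \<and> continuous_on X (\<lambda>x. (\<alpha>' ^^ n) x)"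
  proof (induction n)
    case (Suc n)
    then have IH: "continuous_on X (\<lambda>x. (\<alpha> ^^ n) x)" "continuous_on X (\<lambda>x. (\<alpha>' ^^ n) x)" by auto
    have "(\<lambda>x. (\<alpha> ^^ n) x) ` X \<subseteq> X" "(\<lambda>x. (\<alpha>' ^^ n) x) ` X \<subseteq> X" by auto
    then show ?case
      using continuous_on_compose2[OF Suc.prems(1) IH(1)] continuous_on_compose2[OF Suc.prems(2) IH(2)]
      by simp
  qed simp
  then show "continuous_on X (\<alpha> ^^ n)" "continuous_on X (\<alpha>' ^^ n)" by simp_all
qed

lemma loc_const_pow:
  assumes "loc_const X f"
  shows "loc_const X (\<lambda>x. f ((\<alpha> ^^ n) x))" "loc_const X (\<lambda>x. f ((\<alpha>' ^^ n) x))"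
  by (rule loc_const_compose[OF assms continuous_pow(1)], simp)
     (rule loc_const_compose[OF assms continuous_pow(2)], simp)

text \<open>A periodic orbit is a finite closed invariant set, so minimality would make
  \<open>X\<close> finite, while every point of a Cantor set is a limit point.\<close>

lemma aperiodic:
  assumes "x \<in> X" "n > 0"
  shows "(\<alpha> ^^ n) x \<noteq> x"
proof
  assume per: "(\<alpha> ^^ n) x = x"
  define Z where "Z = (\<lambda>i. (\<alpha> ^^ i) x) ` {..<n}"
  have "Z \<subseteq> X" "finite Z" "Z \<noteq> {}" using assms by (auto simp: Z_def)
  have "\<alpha> ` Z = (\<lambda>i. (\<alpha> ^^ i) x) ` (Suc ` {..<n})" by (simp add: Z_def image_image)
  also have "Suc ` {..<n} = insert n {0<..<n}" using assms(2)
    by (auto simp: image_Suc_lessThan)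
  also have "(\<lambda>i. (\<alpha> ^^ i) x) ` insert n {0<..<n} = (\<lambda>i. (\<alpha> ^^ i) x) ` insert 0 {0<..<n}"
    using per by simp
  also have "insert 0 {0<..<n} = {..<n}" using assms(2) by auto
  finally have "\<alpha> ` Z = Z" by (simp add: Z_def)
  moreover have "closedin (top_of_set X) Z"
    using \<open>Z \<subseteq> X\<close> \<open>finite Z\<close> by (simp add: closed_subset finite_imp_closed)
  ultimately have "finite X" using minimal \<open>finite Z\<close> \<open>Z \<noteq> {}\<close> by blast
  moreover have "x islimpt X" using cantor assms(1) by (auto simp: cantor_set_def)
  ultimately show False using islimpt_finite by blast
qed

text \<open>The points whose two-sided orbit avoids \<open>C\<close> form a closed set
  \<open>Z\<close>; looking in both directions makes it exactly invariant, hence empty by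
  minimality. The one-sided claims follow because compactness bounds the hitting time by some
  \<open>M\<close>.\<close>

lemma visits:
  assumes C: "loc_const X (\<lambda>x. x \<in> C)" "C \<subseteq> X" "C \<noteq> {}" and x: "x \<in> X"
  shows "\<exists>n>0. (\<alpha> ^^ n) x \<in> C" "\<exists>n. (\<alpha>' ^^ n) x \<in> C"
proof -
  define hit where "hit n x \<longleftrightarrow> (\<alpha> ^^ n) x \<in> C \<or> (\<alpha>' ^^ n) x \<in> C" for n x
  have lc: "loc_const X (hit n)" for n
    unfolding hit_def using loc_const_comp2[OF loc_const_pow(1)[OF C(1)] loc_const_pow(2)[OF C(1)]] .
  define Z where "Z = {x\<in>X. \<forall>n. \<not> hit n x}"
  have "Z = (\<Inter>n. {x\<in>X. \<not> hit n x})" by (auto simp: Z_def)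
  moreover have "closedin (top_of_set X) {x\<in>X. \<not> hit n x}" for n
    using loc_const_closedin[OF lc] .
  ultimately have "closedin (top_of_set X) Z" by (simp add: closedin_INT)
  moreover have "\<alpha> ` Z = Z"
  proof
    have *: "hit (Suc n) x \<or> hit (n - 1) x" if "hit n (\<alpha> x)" "x \<in> X" for n x
      using that unfolding hit_def by (cases n) (auto simp: funpow_swap1)
    then show "\<alpha> ` Z \<subseteq> Z" unfolding Z_def by auto
    have "hit (Suc n) x \<or> hit (n - 1) x" if "hit n (\<alpha>' x)" "x \<in> X" for n x
      using that unfolding hit_def by (cases n) (auto simp: funpow_swap1)
    then have bwd: "\<alpha>' x \<in> Z" if "x \<in> Z" for x using that unfolding Z_def by auto
    show "Z \<subseteq> \<alpha> ` Z"
    proof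
      fix x assume "x \<in> Z"
      moreover from this have "x = \<alpha> (\<alpha>' x)" by (simp add: Z_def)
      ultimately show "x \<in> \<alpha> ` Z" using bwd by blast
    qed
  qed
  moreover have "Z \<noteq> X"
  proof -
    obtain c where "c \<in> C" using C(3) by auto
    then have "hit 0 c" "c \<in> X" using C(2) by (auto simp: hit_def)
    then show ?thesis unfolding Z_def by auto
  qed
  ultimately have "Z = {}" using minimal by blast
  then have ex: "\<exists>n. hit n x" if "x \<in> X" for x using that by (auto simp: Z_def)
  define g where "g x = (LEAST n. hit n x)" for x
  have "loc_const X g" unfolding g_def using lc ex by (rule loc_const_Least)
  then have "finite (g ` X)" using compact_X by (intro loc_const_finite_range)
  then obtain M where M: "\<And>x. x \<in> X \<Longrightarrow> g x \<le> M"
    unfolding finite_nat_set_iff_bounded_le by blast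
  have hit: "\<exists>n\<le>M. hit n x" if "x \<in> X" for x
    using LeastI_ex[OF ex[OF that]] M[OF that] unfolding g_def by blast
  \<comment> \<open>From a start \<open>Suc M\<close> steps ahead, a visit within \<open>M\<close>
    steps in either direction is still strictly in the future of \<open>x\<close>.\<close>
  obtain n where n: "n \<le> M" "hit n ((\<alpha> ^^ Suc M) x)" using hit[of "(\<alpha> ^^ Suc M) x"] x by auto
  have "(\<alpha> ^^ (n + Suc M)) x = (\<alpha> ^^ n) ((\<alpha> ^^ Suc M) x)" by (metis comp_apply funpow_add)
  moreover have "(\<alpha>' ^^ n) ((\<alpha> ^^ Suc M) x) = (\<alpha> ^^ (Suc M - n)) x"
    using pow_back_forth(1)[OF x, of n "Suc M"] n(1) by simp
  ultimately have "(\<alpha> ^^ (n + Suc M)) x \<in> C \<or> (\<alpha> ^^ (Suc M - n)) x \<in> C"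
    using n(2) unfolding hit_def by metis
  moreover have "n + Suc M > 0" "Suc M - n > 0" using n(1) by auto
  ultimately show "\<exists>n>0. (\<alpha> ^^ n) x \<in> C" by blast
  obtain n where n: "n \<le> M" "hit n ((\<alpha>' ^^ M) x)" using hit[of "(\<alpha>' ^^ M) x"] x by auto
  have "(\<alpha>' ^^ (n + M)) x = (\<alpha>' ^^ n) ((\<alpha>' ^^ M) x)" by (metis comp_apply funpow_add)
  moreover have "(\<alpha> ^^ n) ((\<alpha>' ^^ M) x) = (\<alpha>' ^^ (M - n)) x"
    using pow_back_forth(2)[OF x, of n M] n(1) by simp
  ultimately show "\<exists>n. (\<alpha>' ^^ n) x \<in> C"
    using n(2) unfolding hit_def by metis
qed

text \<open>The Kakutani--Rokhlin tower over a clopen base \<open>C\<close>, presented pointwise: \<open>k x\<close> is the level of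
  \<open>x\<close> and \<open>W x\<close> is the word of \<open>q\<close>-values read along the column through \<open>x\<close>.\<close>

lemma tower_words:
  fixes q :: "'a \<Rightarrow> 'q"
  assumes C: "loc_const X (\<lambda>x. x \<in> C)" "C \<subseteq> X" "C \<noteq> {}" and q: "loc_const X q"
  obtains W :: "'a \<Rightarrow> 'q list" and k :: "'a \<Rightarrow> nat"
  where "loc_const X W" "loc_const X k"
    "\<And>x. x \<in> X \<Longrightarrow> k x < length (W x)"
    "\<And>x. x \<in> X \<Longrightarrow> W x ! k x = q x"
    "\<And>x. x \<in> X \<Longrightarrow> Suc (k x) < length (W x) \<Longrightarrow> W (\<alpha> x) = W x \<and> k (\<alpha> x) = Suc (k x)"
    "\<And>x. x \<in> X \<Longrightarrow> Suc (k x) = length (W x) \<Longrightarrow> \<alpha> x \<in> C"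
    "\<And>x. x \<in> X \<Longrightarrow> k x = 0 \<longleftrightarrow> x \<in> C"
    "\<And>x j. x \<in> X \<Longrightarrow> j < length (W x) \<Longrightarrow> \<exists>y\<in>X. W y = W x \<and> k y = j"
    "\<And>x. x \<in> C \<Longrightarrow> (\<alpha> ^^ length (W x)) x \<in> C"
proof -
  \<comment> \<open>\<open>k\<close> is the time since the latest visit to \<open>C\<close>,
    \<open>b\<close> the point of that visit, \<open>r\<close> the first return time. Words are read
    from \<open>b x\<close>, so they are the same along a whole column.\<close>
  define k where "k x = (LEAST n. (\<alpha>' ^^ n) x \<in> C)" for x
  define b where "b x = (\<alpha>' ^^ k x) x" for x
  define r where "r x = (LEAST n. n > 0 \<and> (\<alpha> ^^ n) x \<in> C)" for x
  define W where "W x = map (\<lambda>i. q ((\<alpha> ^^ i) (b x))) [0..<r (b x)]" for x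
  have lck: "loc_const X k"
    unfolding k_def using loc_const_pow(2)[OF C(1)] visits(2)[OF C] by (rule loc_const_Least)
  have lcr: "loc_const X r"
    unfolding r_def using loc_const_comp[OF loc_const_pow(1)[OF C(1)]] visits(1)[OF C]
    by (rule loc_const_Least)
  \<comment> \<open>Both the length of the word and the number of steps back to the base vary with
    the point, so \<open>loc_const_choose\<close> is applied once for each.\<close>
  have "loc_const X (\<lambda>x. map (\<lambda>i. q ((\<alpha> ^^ i) x)) [0..<m])" for m
    by (rule loc_const_map) (rule loc_const_pow(1)[OF q])
  with lcr have "loc_const X (\<lambda>x. map (\<lambda>i. q ((\<alpha> ^^ i) x)) [0..<r x])" by (rule loc_const_choose)
  from loc_const_pow(2)[OF this] have lcW: "loc_const X W"
    unfolding W_def b_def by (rule loc_const_choose[OF lck])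
  have r: "r x > 0" "(\<alpha> ^^ r x) x \<in> C" "\<And>n. 0 < n \<Longrightarrow> n < r x \<Longrightarrow> (\<alpha> ^^ n) x \<notin> C" if "x \<in> X" for x
    using LeastI_ex[OF visits(1)[OF C that]] not_less_Least[of _ "\<lambda>n. n > 0 \<and> (\<alpha> ^^ n) x \<in> C"]
    unfolding r_def by auto
  have k: "(\<alpha>' ^^ k x) x \<in> C" "\<And>n. n < k x \<Longrightarrow> (\<alpha>' ^^ n) x \<notin> C" if "x \<in> X" for x
    using LeastI_ex[OF visits(2)[OF C that]] not_less_Least[of _ "\<lambda>n. (\<alpha>' ^^ n) x \<in> C"]
    unfolding k_def by auto
  have level: "k ((\<alpha> ^^ j) c) = j" "b ((\<alpha> ^^ j) c) = c" if c: "c \<in> C" and j: "j < r c" for c j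
  proof -
    have cX: "c \<in> X" using c C(2) by auto
    show "k ((\<alpha> ^^ j) c) = j" unfolding k_def
    proof (rule Least_equality)
      show "(\<alpha>' ^^ j) ((\<alpha> ^^ j) c) \<in> C" using c cX by simp
      fix i assume i: "(\<alpha>' ^^ i) ((\<alpha> ^^ j) c) \<in> C"
      show "j \<le> i"
      proof (rule ccontr)
        assume "\<not> j \<le> i"
        then have "(\<alpha> ^^ (j - i)) c \<in> C" "0 < j - i" "j - i < r c"
          using i j pow_back_forth(1)[OF cX, of i j] by auto
        with r(3)[OF cX] show False by blast
      qed
    qed
    then show "b ((\<alpha> ^^ j) c) = c" using cX by (simp add: b_def)
  qed
  have base: "b x \<in> C" "b x \<in> X" "(\<alpha> ^^ k x) (b x) = x" if "x \<in> X" for x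
    using k(1)[OF that] C(2) that by (auto simp: b_def)
  \<comment> \<open>Otherwise the first return of \<open>b x\<close> would be a visit to
    \<open>C\<close> no later than \<open>x\<close> and more recent than \<open>b x\<close>, against
    the choice of \<open>k\<close>.\<close>
  have less: "k x < r (b x)" if x: "x \<in> X" for x
  proof (rule ccontr)
    assume n: "\<not> k x < r (b x)"
    have "(\<alpha> ^^ r (b x)) (b x) = (\<alpha>' ^^ (k x - r (b x))) x"
      using pow_back_forth(2)[OF x, of "r (b x)" "k x"] n by (simp add: b_def)
    then have "(\<alpha>' ^^ (k x - r (b x))) x \<in> C" using r(2)[OF base(2)[OF x]] by simp
    moreover have "k x - r (b x) < k x" using r(1)[OF base(2)[OF x]] n by simp
    ultimately show False using k(2)[OF x] by blast
  qed
  have zero: "k x = 0 \<longleftrightarrow> x \<in> C" if "x \<in> X" for x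
    using k[OF that] by (metis funpow_0 gr0I)
  have next_level: "\<alpha> x = (\<alpha> ^^ Suc (k x)) (b x)" if "x \<in> X" for x
    using base(3)[OF that] by simp
  show ?thesis
  proof (rule that[of W k])
    show "loc_const X W" "loc_const X k" by fact+
    fix x assume x: "x \<in> X"
    show "k x < length (W x)" "W x ! k x = q x"
      using less[OF x] base(3)[OF x] by (simp_all add: W_def)
    show "W (\<alpha> x) = W x \<and> k (\<alpha> x) = Suc (k x)" if "Suc (k x) < length (W x)"
      using level[OF base(1)[OF x], of "Suc (k x)"] next_level[OF x] that by (simp add: W_def)
    show "\<alpha> x \<in> C" if "Suc (k x) = length (W x)"
      using next_level[OF x] that r(2)[OF base(2)[OF x]] by (simp add: W_def)
    show "k x = 0 \<longleftrightarrow> x \<in> C" using zero[OF x] .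
    show "\<exists>y\<in>X. W y = W x \<and> k y = j" if "j < length (W x)" for j
      using level[OF base(1)[OF x], of j] that base(2)[OF x]
      by (intro bexI[of _ "(\<alpha> ^^ j) (b x)"]) (simp_all add: W_def)
  next
    fix x assume x: "x \<in> C"
    then have "x \<in> X" "b x = x" using C(2) zero[of x] by (auto simp: b_def)
    then show "(\<alpha> ^^ length (W x)) x \<in> C" using r(2)[of x] by (simp add: W_def)
  qed
qed

text \<open>\<open>C\<close> collects the points of \<open>D\<close> whose labels along the iterates
  up to \<open>N\<close> agree with those of a fixed \<open>x\<close>. As \<open>x\<close> is not
  periodic, fine enough labels tell it apart from its next iterates, and the points of
  \<open>C\<close> inherit this.\<close>

lemma small_base:
  assumes D: "loc_const X (\<lambda>x. x \<in> D)" "D \<subseteq> X" "D \<noteq> {}" and "e > 0"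
  obtains C where "loc_const X (\<lambda>x. x \<in> C)" "C \<subseteq> D" "C \<noteq> {}"
    "\<And>x y. x \<in> C \<Longrightarrow> y \<in> C \<Longrightarrow> dist x y < e"
    "\<And>x j. x \<in> C \<Longrightarrow> 0 < j \<Longrightarrow> j < N \<Longrightarrow> (\<alpha> ^^ j) x \<notin> C"
proof -
  obtain x where x: "x \<in> D" "x \<in> X" using D by auto
  \<comment> \<open>At most \<open>e\<close> for the distances within \<open>C\<close>, and at most
    the distance from \<open>x\<close> to each of its iterates before \<open>N\<close> for the
    return time.\<close>
  define d where "d = Min (insert e ((\<lambda>j. dist ((\<alpha> ^^ j) x) x) ` {0<..<N}))"
  have d: "d > 0" "d \<le> e" "\<And>j. 0 < j \<Longrightarrow> j < N \<Longrightarrow> d \<le> dist ((\<alpha> ^^ j) x) x"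
    using aperiodic[OF x(2)] assms(4) by (auto simp: d_def)
  obtain c :: "'a \<Rightarrow> nat" where c: "loc_const X c" "\<And>x y. x \<in> X \<Longrightarrow> y \<in> X \<Longrightarrow> c x = c y \<Longrightarrow> dist x y < d"
    using cantor_set_fine_labels[OF cantor d(1)] by metis
  define w where "w y = map (\<lambda>j. c ((\<alpha> ^^ j) y)) [0..<Suc N]" for y
  define C where "C = {y\<in>D. w y = w x}"
  have "loc_const X w" unfolding w_def by (rule loc_const_map) (rule loc_const_pow(1)[OF c(1)])
  from loc_const_comp2[OF D(1) this, of "\<lambda>p v. p \<and> v = w x"]
  have "loc_const X (\<lambda>x. x \<in> C)" by (simp add: C_def)
  moreover have wc: "c ((\<alpha> ^^ j) y) = c ((\<alpha> ^^ j) x)" if "y \<in> C" "j \<le> N" for y j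
    using that unfolding C_def w_def by (auto simp: map_eq_conv simp del: upt_Suc)
  have "dist y z < e" if "y \<in> C" "z \<in> C" for y z
  proof -
    have "c y = c z" using wc[OF that(1), of 0] wc[OF that(2), of 0] by simp
    moreover have "y \<in> X" "z \<in> X" using that D(2) by (auto simp: C_def)
    ultimately show ?thesis using c(2) d(2) by fastforce
  qed
  moreover have "(\<alpha> ^^ j) y \<notin> C" if "y \<in> C" "0 < j" "j < N" for y j
  proof
    assume "(\<alpha> ^^ j) y \<in> C"
    then have "c ((\<alpha> ^^ j) y) = c x" using wc[of "(\<alpha> ^^ j) y" 0] by simp
    then have "c ((\<alpha> ^^ j) x) = c x" using wc[OF that(1), of j] that(3) by simp
    then have "dist ((\<alpha> ^^ j) x) x < d" using c(2) x(2) by simp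
    with d(3)[OF that(2,3)] show False by simp
  qed
  moreover have "C \<subseteq> D" "C \<noteq> {}" using x by (auto simp: C_def)
  ultimately show ?thesis using that by blast
qed

section \<open>The periodic spectrum in terms of phases modulo p\<close>

lemma phase_pow:
  fixes q :: "'a \<Rightarrow> nat"
  assumes "\<And>x. x \<in> X \<Longrightarrow> q (\<alpha> x) mod p = Suc (q x) mod p" "x \<in> X"
  shows "q ((\<alpha> ^^ i) x) mod p = (q x + i) mod p"
proof (induction i)
  case (Suc i)
  have "q ((\<alpha> ^^ Suc i) x) mod p = Suc (q ((\<alpha> ^^ i) x)) mod p" using assms by simp
  with Suc show ?case by (metis add_Suc_right mod_Suc_eq)
qed simp

text \<open>A phase records which translate of \<open>U\<close> contains the point; conversely
  \<open>U\<close> is the set of phase 0. Only residues of \<open>q\<close> matter, so the levels of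
  a tower can serve as \<open>q\<close> directly.\<close>

lemma periodic_spectrum_iff:
  "p \<in> periodic_spectrum X \<alpha> \<longleftrightarrow>
     p > 0 \<and> (\<exists>q :: 'a \<Rightarrow> nat. loc_const X q \<and> (\<forall>x\<in>X. q (\<alpha> x) mod p = Suc (q x) mod p))"
proof
  assume "p \<in> periodic_spectrum X \<alpha>"
  then obtain U where p: "p > 0" and U: "U \<subseteq> X" "openin (top_of_set X) U" "closedin (top_of_set X) U"
     "pairwise (\<lambda>i j. disjnt ((\<alpha> ^^ i) ` U) ((\<alpha> ^^ j) ` U)) {..<p}" "(\<Union>k<p. (\<alpha> ^^ k) ` U) = X"
    by (auto simp: periodic_spectrum_def)
  have img: "x \<in> (\<alpha> ^^ i) ` U \<longleftrightarrow> (\<alpha>' ^^ i) x \<in> U" if "x \<in> X" for x i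
  proof
    show "x \<in> (\<alpha> ^^ i) ` U \<Longrightarrow> (\<alpha>' ^^ i) x \<in> U" using U(1) by auto
    show "(\<alpha>' ^^ i) x \<in> U \<Longrightarrow> x \<in> (\<alpha> ^^ i) ` U" using that by (metis image_eqI pow_inverse(2))
  qed
  have uniq: "i = j" if "x \<in> X" "(\<alpha>' ^^ i) x \<in> U" "(\<alpha>' ^^ j) x \<in> U" "i < p" "j < p" for x i j
  proof (rule ccontr)
    assume "i \<noteq> j"
    then have "disjnt ((\<alpha> ^^ i) ` U) ((\<alpha> ^^ j) ` U)"
      using U(4) that(4,5) unfolding pairwise_def by simp
    moreover have "x \<in> (\<alpha> ^^ i) ` U" "x \<in> (\<alpha> ^^ j) ` U" using that img by simp_all
    ultimately show False by (meson disjnt_iff)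
  qed
  have ex: "\<exists>i<p. (\<alpha>' ^^ i) x \<in> U" if "x \<in> X" for x
    using U(5) that img[OF that] by blast
  define q where "q x = (LEAST i. i < p \<and> (\<alpha>' ^^ i) x \<in> U)" for x
  have qq: "q x < p" "(\<alpha>' ^^ q x) x \<in> U" if "x \<in> X" for x
    using LeastI_ex[OF ex[OF that]] by (auto simp: q_def)
  have "loc_const X q"
    unfolding q_def using loc_const_comp[OF loc_const_pow(2)[OF clopen_imp_loc_const[OF U(2,3)]]] ex
    by (rule loc_const_Least)
  moreover have "q (\<alpha> x) mod p = Suc (q x) mod p" if x: "x \<in> X" for x
  proof (cases "q (\<alpha> x)")
    case 0
    \<comment> \<open>Phase 0 at \<open>\<alpha> x\<close> must be a wrap-around: if
      \<open>Suc (q x)\<close> were below \<open>p\<close>, then \<open>\<alpha> x\<close> would lie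
      in two different translates of \<open>U\<close>.\<close>
    have "\<not> Suc (q x) < p"
    proof
      assume "Suc (q x) < p"
      moreover have "(\<alpha>' ^^ Suc (q x)) (\<alpha> x) \<in> U" using qq(2)[OF x] x by (simp add: funpow_swap1)
      moreover have "(\<alpha>' ^^ 0) (\<alpha> x) \<in> U" using qq(2)[of "\<alpha> x"] x 0 by simp
      ultimately show False using uniq[of "\<alpha> x" "Suc (q x)" 0] x p by simp
    qed
    then have "Suc (q x) = p" using qq(1)[OF x] by simp
    with 0 show ?thesis by simp
  next
    case (Suc i)
    have "(\<alpha>' ^^ Suc i) (\<alpha> x) \<in> U" using qq(2)[of "\<alpha> x"] x Suc by simp
    then have "(\<alpha>' ^^ i) x \<in> U" using x by (simp add: funpow_swap1)
    moreover have "i < p" using qq(1)[of "\<alpha> x"] x Suc by simp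
    ultimately have "i = q x" using uniq[OF x] qq[OF x] by blast
    with Suc show ?thesis by simp
  qed
  ultimately show "p > 0 \<and> (\<exists>q :: 'a \<Rightarrow> nat. loc_const X q \<and> (\<forall>x\<in>X. q (\<alpha> x) mod p = Suc (q x) mod p))"
    using p by blast
next
  assume "p > 0 \<and> (\<exists>q :: 'a \<Rightarrow> nat. loc_const X q \<and> (\<forall>x\<in>X. q (\<alpha> x) mod p = Suc (q x) mod p))"
  then obtain q :: "'a \<Rightarrow> nat" where p: "p > 0" and q: "loc_const X q"
    "\<And>x. x \<in> X \<Longrightarrow> q (\<alpha> x) mod p = Suc (q x) mod p" by blast
  define U where "U = {x\<in>X. q x mod p = 0}"
  have pow: "q ((\<alpha> ^^ i) x) mod p = (q x + i) mod p" if "x \<in> X" for x i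
    using q(2) that by (rule phase_pow)
  have img: "(\<alpha> ^^ i) ` U = {x\<in>X. q x mod p = i}" if i: "i < p" for i
  proof (intro equalityI subsetI)
    fix x assume "x \<in> (\<alpha> ^^ i) ` U"
    then obtain y where "y \<in> X" "q y mod p = 0" "x = (\<alpha> ^^ i) y" by (auto simp: U_def)
    moreover from this have "q x mod p = (q y mod p + i) mod p" using pow by (metis mod_add_left_eq)
    ultimately show "x \<in> {x\<in>X. q x mod p = i}" using i by simp
  next
    fix x assume "x \<in> {x\<in>X. q x mod p = i}"
    then have x: "x \<in> X" "q x mod p = i" by auto
    have "(q ((\<alpha>' ^^ i) x) + i) mod p = (0 + i) mod p" using pow[of "(\<alpha>' ^^ i) x" i] x i by simp
    then have "[q ((\<alpha>' ^^ i) x) + i = 0 + i] (mod p)" by (simp add: cong_def)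
    then have "q ((\<alpha>' ^^ i) x) mod p = 0" by (metis cong_add_rcancel_nat cong_def mod_0)
    then have "(\<alpha>' ^^ i) x \<in> U" using x(1) by (simp add: U_def)
    then show "x \<in> (\<alpha> ^^ i) ` U" using x(1) by (metis image_eqI pow_inverse(2))
  qed
  have "pairwise (\<lambda>i j. disjnt ((\<alpha> ^^ i) ` U) ((\<alpha> ^^ j) ` U)) {..<p}"
    using img by (auto simp: pairwise_def disjnt_iff)
  moreover have "(\<Union>k<p. (\<alpha> ^^ k) ` U) = X" using img p by auto
  moreover have "openin (top_of_set X) U" "closedin (top_of_set X) U" "U \<subseteq> X"
    unfolding U_def using loc_const_openin[OF q(1)] loc_const_closedin[OF q(1)] by auto
  ultimately show "p \<in> periodic_spectrum X \<alpha>" using p unfolding periodic_spectrum_def by blast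
qed

end

section \<open>Approximate conjugacy of Cantor minimal systems\<close>

text \<open>The coin problem with the extra demand that every \<open>v\<close> occurs in
  \<open>ws\<close>. In the induction, copies of the new \<open>v\<close> are taken until the
  residue of \<open>r\<close> modulo the gcd \<open>D\<close> of the other heights is reached; the
  rest is a large multiple of \<open>D\<close>.\<close>

lemma large_multiples_of_Gcd:
  fixes h :: "'v \<Rightarrow> nat"
  assumes "finite V" "V \<noteq> {}" "\<And>v. v \<in> V \<Longrightarrow> h v > 0"
  shows "\<exists>N. \<forall>r\<ge>N. Gcd (h ` V) dvd r \<longrightarrow> (\<exists>ws. set ws = V \<and> sum_list (map h ws) = r)"
  using assms
proof (induction rule: finite_ne_induct)
  case (singleton v)
  have "\<exists>ws. set ws = {v} \<and> sum_list (map h ws) = r" if "r \<ge> h v" "h v dvd r" for r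
  proof (intro exI conjI)
    have "r div h v > 0" using that singleton by (simp add: div_greater_zero_iff)
    then show "set (replicate (r div h v) v) = {v}" by simp
    show "sum_list (map h (replicate (r div h v) v)) = r"
      using that by (simp add: sum_list_replicate)
  qed
  then show ?case by (intro exI[of _ "h v"]) auto
next
  case (insert v V)
  define D where "D = Gcd (h ` V)"
  have "D > 0" using insert unfolding D_def by (metis Gcd_0_iff all_not_in_conv gr0I image_eqI insertCI
        less_numeral_extra(3) singletonD subsetD)
  obtain N where N: "\<And>r. r \<ge> N \<Longrightarrow> D dvd r \<Longrightarrow> \<exists>ws. set ws = V \<and> sum_list (map h ws) = r"
    using insert unfolding D_def by auto
  have "\<exists>ws. set ws = insert v V \<and> sum_list (map h ws) = r"
    if r: "r \<ge> N + D * h v" "Gcd (h ` insert v V) dvd r" for r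
  proof -
    have "gcd (h v) D dvd r" using r(2) by (simp add: D_def)
    then obtain a where a: "[h v * a = r] (mod D)" using cong_solve_dvd_nat by blast
    \<comment> \<open>Residue 0 is replaced by \<open>D\<close> so that \<open>v\<close> is used at
      least once. The bound \<open>a' \<le> D\<close> accounts for the summand
      \<open>D * h v\<close> in the threshold.\<close>
    define a' where "a' = (if a mod D = 0 then D else a mod D)"
    have a': "0 < a'" "a' \<le> D" using \<open>D > 0\<close> by (auto simp: a'_def intro: less_imp_le)
    have "[a' = a] (mod D)" by (simp add: a'_def cong_def)
    then have "[r = h v * a'] (mod D)"
      using a by (metis cong_scalar_left cong_sym cong_trans)
    moreover have le: "h v * a' \<le> D * h v" using a'(2) by (simp add: mult.commute)
    ultimately have "D dvd r - h v * a'" using r(1) by (simp add: cong_altdef_nat)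
    moreover have "r - h v * a' \<ge> N" using r(1) le by linarith
    ultimately obtain ws where "set ws = V" "sum_list (map h ws) = r - h v * a'" using N by blast
    moreover have "a' * h v + (r - h v * a') = r" using le r(1) mult.commute[of a' "h v"] by linarith
    ultimately show ?thesis using a'(1)
      by (intro exI[of _ "replicate a' v @ ws"]) (auto simp: sum_list_replicate)
  qed
  then show ?case by blast
qed

text \<open>The moves that towers permit on pairs of column and level: one level up, or from a top
  to the bottom of any column. It is a relation because the next column is not determined.\<close>

definition tower_step :: "'q list \<times> nat \<Rightarrow> 'q list \<times> nat \<Rightarrow> bool" where
  "tower_step a b \<longleftrightarrow>
     (if Suc (snd a) < length (fst a) then b = (fst a, Suc (snd a)) else snd b = 0)"

definition levels :: "'q list \<Rightarrow> ('q list \<times> nat) list" where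
  "levels w = map (Pair w) [0..<length w]"

lemma successively_levels: "successively tower_step (levels w)"
  by (auto simp: successively_conv_nth levels_def tower_step_def)

text \<open>Only the junctions need an argument: there a top is followed by a bottom, which
  \<open>tower_step\<close> always permits. The claims on the first and last entries serve the same
  purpose between two columns of \<open>X\<close>.\<close>

lemma concat_levels:
  assumes "\<And>w. w \<in> set ws \<Longrightarrow> w \<noteq> []"
  shows "successively tower_step (concat (map levels ws))"
    and "length (concat (map levels ws)) = sum_list (map length ws)"
    and "set (concat (map levels ws)) = {(w, j). w \<in> set ws \<and> j < length w}"
    and "ws \<noteq> [] \<Longrightarrow> snd (hd (concat (map levels ws))) = 0"
    and "ws \<noteq> [] \<Longrightarrow> \<not> Suc (snd (last (concat (map levels ws)))) < length (fst (last (concat (map levels ws))))"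
proof -
  have hd: "snd (hd (levels w)) = 0" "levels w \<noteq> []" if "w \<noteq> []" for w :: "'a list"
    using that by (simp_all add: levels_def hd_map)
  have last: "\<not> Suc (snd (last (levels w))) < length (fst (last (levels w)))" if "w \<noteq> []" for w :: "'a list"
    using that by (simp add: levels_def last_map)
  have hds: "ws \<noteq> [] \<Longrightarrow> snd (hd (concat (map levels ws))) = 0"
    if "\<And>w. w \<in> set ws \<Longrightarrow> w \<noteq> []" for ws :: "'a list list"
    using that hd by (cases ws) (auto simp: hd_append)
  show "ws \<noteq> [] \<Longrightarrow> snd (hd (concat (map levels ws))) = 0" using assms hds by blast
  show "length (concat (map levels ws)) = sum_list (map length ws)"
    by (induction ws) (auto simp: levels_def)
  show "set (concat (map levels ws)) = {(w, j). w \<in> set ws \<and> j < length w}"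
    by (auto simp: levels_def)
  show "ws \<noteq> [] \<Longrightarrow> \<not> Suc (snd (last (concat (map levels ws)))) < length (fst (last (concat (map levels ws))))"
    using assms
  proof (induction ws rule: rev_induct)
    case (snoc w ws)
    then have "w \<noteq> []" by simp
    then show ?case using last[of w] hd(2)[of w] by simp
  qed simp
  show "successively tower_step (concat (map levels ws))" using assms
  proof (induction ws)
    case (Cons w ws)
    have "tower_step (last (levels w)) (hd (concat (map levels ws)))" if "concat (map levels ws) \<noteq> []"
    proof -
      have "w \<noteq> []" "ws \<noteq> []" "\<And>v. v \<in> set ws \<Longrightarrow> v \<noteq> []" using Cons.prems that by auto
      then show ?thesis using last[of w] hds[of ws] by (simp add: tower_step_def)
    qed
    with Cons show ?case by (auto simp: successively_append_iff successively_levels)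
  qed simp
qed

text \<open>Each column of \<open>X\<close> is labelled by a concatenation of complete columns of
  \<open>Y\<close>. A label-preserving \<open>s\<close> turns every step of \<open>\<alpha>\<close>
  into a \<open>tower_step\<close>, and up to \<open>e\<close> that is a step of
  \<open>\<beta>\<close>.\<close>

theorem approximate_conjugacy:
  fixes X :: "'a::metric_space set" and Y :: "'b::metric_space set"
  assumes "cantor_minimal_system X \<alpha>" "cantor_minimal_system Y \<beta>"
    and PS: "periodic_spectrum Y \<beta> \<subseteq> periodic_spectrum X \<alpha>" and "e > 0"
  obtains s s' where "homeomorphism X Y s s'" "\<And>x. x \<in> X \<Longrightarrow> dist (s (\<alpha> x)) (\<beta> (s x)) < e"
proof -
  interpret A: cantor_minimal X \<alpha> by standard fact
  interpret B: cantor_minimal Y \<beta> by standard fact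
  have "loc_const Y (\<lambda>y. y \<in> Y)" by (rule loc_const_cong[THEN iffD1, OF _ loc_const_const[of Y True]]) simp
  then obtain B0 where B0: "loc_const Y (\<lambda>y. y \<in> B0)" "B0 \<subseteq> Y" "B0 \<noteq> {}"
    "\<And>y z. y \<in> B0 \<Longrightarrow> z \<in> B0 \<Longrightarrow> dist y z < e"
    using B.small_base[of Y e 0] B.X_nonempty \<open>e > 0\<close> by (metis order_refl)
  obtain c :: "'b \<Rightarrow> nat" where c: "loc_const Y c"
    "\<And>y z. y \<in> Y \<Longrightarrow> z \<in> Y \<Longrightarrow> c y = c z \<Longrightarrow> dist y z < e"
    using cantor_set_fine_labels[OF B.cantor \<open>e > 0\<close>] by metis
  \<comment> \<open>With the fine labels \<open>c\<close> written into the words, word and level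
    together determine a point of \<open>Y\<close> up to \<open>e\<close>.\<close>
  obtain W :: "'b \<Rightarrow> nat list" and k where W: "loc_const Y W" "loc_const Y k"
    "\<And>x. x \<in> Y \<Longrightarrow> k x < length (W x)"
    "\<And>x. x \<in> Y \<Longrightarrow> W x ! k x = c x"
    "\<And>x. x \<in> Y \<Longrightarrow> Suc (k x) < length (W x) \<Longrightarrow> W (\<beta> x) = W x \<and> k (\<beta> x) = Suc (k x)"
    "\<And>x. x \<in> Y \<Longrightarrow> Suc (k x) = length (W x) \<Longrightarrow> \<beta> x \<in> B0"
    "\<And>x. x \<in> Y \<Longrightarrow> k x = 0 \<longleftrightarrow> x \<in> B0"
    "\<And>x j. x \<in> Y \<Longrightarrow> j < length (W x) \<Longrightarrow> \<exists>y\<in>Y. W y = W x \<and> k y = j"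
    "\<And>x. x \<in> B0 \<Longrightarrow> (\<beta> ^^ length (W x)) x \<in> B0"
    using B.tower_words[OF B0(1-3) c(1)] by blast
  have top: "Suc (k y) = length (W y)" if "y \<in> Y" "\<not> Suc (k y) < length (W y)" for y
    using W(3)[OF that(1)] that(2) by simp
  define V where "V = W ` Y"
  have V: "finite V" "V \<noteq> {}" "\<And>w. w \<in> V \<Longrightarrow> length w > 0"
    using loc_const_finite_range[OF B.compact_X W(1)] B.X_nonempty W(3) by (fastforce simp: V_def)+
  define d where "d = Gcd (length ` V)"
  have "d > 0" unfolding d_def using V by (metis Gcd_0_iff all_not_in_conv gr0I image_eqI less_numeral_extra(3) singletonD subsetD)
  \<comment> \<open>All heights are multiples of \<open>d\<close>, so the drop from a top level to 0
    is invisible modulo \<open>d\<close> and the level is a phase for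
    \<open>\<beta>\<close>.\<close>
  have "k (\<beta> y) mod d = Suc (k y) mod d" if y: "y \<in> Y" for y
  proof (cases "Suc (k y) < length (W y)")
    case True
    then show ?thesis using W(5)[OF y] by simp
  next
    case False
    have "d dvd length (W y)" using y by (simp add: d_def V_def)
    moreover have "k (\<beta> y) = 0" using W(6)[OF y top[OF y False]] W(7)[of "\<beta> y"] y by simp
    ultimately show ?thesis using top[OF y False] by simp
  qed
  then have "d \<in> periodic_spectrum X \<alpha>"
    using PS B.periodic_spectrum_iff[of d] W(2) \<open>d > 0\<close> by blast
  then obtain q :: "'a \<Rightarrow> nat" where q: "loc_const X q" "\<And>x. x \<in> X \<Longrightarrow> q (\<alpha> x) mod d = Suc (q x) mod d"
    using A.periodic_spectrum_iff by blast
  have qpow: "q ((\<alpha> ^^ i) x) mod d = (q x + i) mod d" if "x \<in> X" for x i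
    using q(2) that by (rule A.phase_pow)
  \<comment> \<open>A base inside the phase-0 set has return times divisible by
    \<open>d\<close>.\<close>
  define D where "D = {x\<in>X. q x mod d = 0}"
  have "loc_const X (\<lambda>x. x \<in> D)"
    by (rule loc_const_cong[THEN iffD1, OF _ loc_const_comp[OF q(1), of "\<lambda>n. n mod d = 0"]]) (simp add: D_def)
  moreover have "D \<subseteq> X" by (auto simp: D_def)
  moreover have "D \<noteq> {}"
  proof -
    obtain x where x: "x \<in> X" using A.X_nonempty by auto
    \<comment> \<open>After \<open>(d - 1) * q x\<close> steps the phase of \<open>x\<close> has
      become \<open>d * q x\<close>, which is 0 modulo \<open>d\<close>.\<close>
    have "q x + (d - 1) * q x = d * q x" using \<open>d > 0\<close> by (cases d) auto
    then have "q ((\<alpha> ^^ ((d - 1) * q x)) x) mod d = 0" using qpow[OF x] by simp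
    then have "(\<alpha> ^^ ((d - 1) * q x)) x \<in> D" using x by (simp add: D_def)
    then show ?thesis by blast
  qed
  moreover obtain N where N: "\<And>r. r \<ge> N \<Longrightarrow> d dvd r \<Longrightarrow> \<exists>ws. set ws = V \<and> sum_list (map length ws) = r"
    using large_multiples_of_Gcd[of V length] V unfolding d_def by blast
  ultimately obtain C where C: "loc_const X (\<lambda>x. x \<in> C)" "C \<subseteq> D" "C \<noteq> {}"
    "\<And>x j. x \<in> C \<Longrightarrow> 0 < j \<Longrightarrow> j < N \<Longrightarrow> (\<alpha> ^^ j) x \<notin> C"
    using A.small_base[of D e N] \<open>e > 0\<close> by metis
  have CX: "C \<subseteq> X" using C(2) \<open>D \<subseteq> X\<close> by simp
  \<comment> \<open>In \<open>X\<close> only the heights are wanted, hence words over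
    \<open>unit\<close>.\<close>
  obtain W' :: "'a \<Rightarrow> unit list" and k' where W': "loc_const X W'" "loc_const X k'"
    "\<And>x. x \<in> X \<Longrightarrow> k' x < length (W' x)"
    "\<And>x. x \<in> X \<Longrightarrow> W' x ! k' x = ()"
    "\<And>x. x \<in> X \<Longrightarrow> Suc (k' x) < length (W' x) \<Longrightarrow> W' (\<alpha> x) = W' x \<and> k' (\<alpha> x) = Suc (k' x)"
    "\<And>x. x \<in> X \<Longrightarrow> Suc (k' x) = length (W' x) \<Longrightarrow> \<alpha> x \<in> C"
    "\<And>x. x \<in> X \<Longrightarrow> k' x = 0 \<longleftrightarrow> x \<in> C"
    "\<And>x j. x \<in> X \<Longrightarrow> j < length (W' x) \<Longrightarrow> \<exists>y\<in>X. W' y = W' x \<and> k' y = j"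
    "\<And>x. x \<in> C \<Longrightarrow> (\<alpha> ^^ length (W' x)) x \<in> C"
    using A.tower_words[OF C(1) CX C(3) loc_const_const[of X "()"]] by blast
  have height: "length (W' x) \<ge> N" "d dvd length (W' x)" if x: "x \<in> X" for x
  proof -
    have pos: "0 < length (W' x)" using W'(3)[OF x] by linarith
    obtain y where y: "y \<in> X" "W' y = W' x" "k' y = 0" using W'(8)[OF x pos] by blast
    then have "y \<in> C" using W'(7) by blast
    then have ret: "(\<alpha> ^^ length (W' x)) y \<in> C" using W'(9)[of y] y by simp
    then show "length (W' x) \<ge> N" using C(4)[OF \<open>y \<in> C\<close> pos] by linarith
    have "q y mod d = 0" "q ((\<alpha> ^^ length (W' x)) y) mod d = 0"
      using \<open>y \<in> C\<close> ret C(2) by (auto simp: D_def)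
    then show "d dvd length (W' x)" using qpow[OF y(1)] by (metis add_0 dvd_eq_mod_eq_0 mod_add_left_eq)
  qed
  obtain ws where ws: "\<And>r. r \<ge> N \<Longrightarrow> d dvd r \<Longrightarrow> set (ws r) = V \<and> sum_list (map length (ws r)) = r"
    using N by metis
  define E where "E r = concat (map levels (ws r))" for r
  define \<rho> where "\<rho> x = E (length (W' x)) ! k' x" for x
  define \<pi> where "\<pi> y = (W y, k y)" for y
  have E: "successively tower_step (E (length (W' x)))" "length (E (length (W' x))) = length (W' x)"
    "set (E (length (W' x))) = {(w, j). w \<in> V \<and> j < length w}"
    "snd (hd (E (length (W' x)))) = 0"
    "\<not> Suc (snd (last (E (length (W' x))))) < length (fst (last (E (length (W' x)))))"
    if "x \<in> X" for x
  proof -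
    have *: "set (ws (length (W' x))) = V" "sum_list (map length (ws (length (W' x)))) = length (W' x)"
      using ws height[OF that] by auto
    moreover have ne: "w \<noteq> []" if "w \<in> set (ws (length (W' x)))" for w using that * V(3) by force
    moreover have "ws (length (W' x)) \<noteq> []" using * V(2) by auto
    ultimately show "successively tower_step (E (length (W' x)))" "length (E (length (W' x))) = length (W' x)"
      "set (E (length (W' x))) = {(w, j). w \<in> V \<and> j < length w}"
      "snd (hd (E (length (W' x)))) = 0"
      "\<not> Suc (snd (last (E (length (W' x))))) < length (fst (last (E (length (W' x)))))"
      unfolding E_def using concat_levels[of "ws (length (W' x))", OF ne] by simp_all
  qed
  have "loc_const X \<rho>" unfolding \<rho>_def using loc_const_comp2[OF W'(1,2), of "\<lambda>w j. E (length w) ! j"] .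
  moreover have "loc_const Y \<pi>" unfolding \<pi>_def using loc_const_comp2[OF W(1,2), of Pair] .
  moreover have "\<rho> ` X = \<pi> ` Y"
  proof -
    have "\<pi> ` Y = {(w, j). w \<in> V \<and> j < length w}"
    proof (intro equalityI subsetI)
      fix l assume "l \<in> {(w, j). w \<in> V \<and> j < length w}"
      then obtain y j where "y \<in> Y" "j < length (W y)" "l = (W y, j)" by (auto simp: V_def)
      moreover from this obtain z where "z \<in> Y" "W z = W y" "k z = j" using W(8) by blast
      ultimately have "z \<in> Y" "l = \<pi> z" by (simp_all add: \<pi>_def)
      then show "l \<in> \<pi> ` Y" by blast
    qed (use W(3) in \<open>auto simp: \<pi>_def V_def\<close>)
    \<comment> \<open>A single column of \<open>X\<close> already shows every label, since each list
      \<open>ws r\<close> in use runs through all of \<open>V\<close>.\<close>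
    moreover have "\<rho> ` X = {(w, j). w \<in> V \<and> j < length w}"
    proof (intro equalityI subsetI)
      fix l assume "l \<in> \<rho> ` X"
      then obtain x where x: "x \<in> X" "l = \<rho> x" by blast
      then have "l \<in> set (E (length (W' x)))" using E(2)[OF x(1)] W'(3)[OF x(1)] by (simp add: \<rho>_def)
      with E(3)[OF x(1)] show "l \<in> {(w, j). w \<in> V \<and> j < length w}" by simp
    next
      fix l assume l: "l \<in> {(w, j). w \<in> V \<and> j < length w}"
      obtain x where x: "x \<in> X" using A.X_nonempty by auto
      with l obtain j where j: "j < length (W' x)" "l = E (length (W' x)) ! j"
        using E(2,3)[OF x] by (metis in_set_conv_nth)
      obtain y where "y \<in> X" "W' y = W' x" "k' y = j" using W'(8)[OF x j(1)] by blast
      then have "l = \<rho> y" using j(2) by (simp add: \<rho>_def)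
      with \<open>y \<in> X\<close> show "l \<in> \<rho> ` X" by blast
    qed
    ultimately show ?thesis by simp
  qed
  ultimately obtain s s' where s: "homeomorphism X Y s s'" "\<And>x. x \<in> X \<Longrightarrow> \<pi> (s x) = \<rho> x"
    using cantor_sets_homeomorphic_labels[OF A.cantor B.cantor] by blast
  \<comment> \<open>Within a column this is the succession inside one list \<open>E\<close>; between
    columns the label passes from the last entry of a list to the first entry of a list, a top
    followed by a bottom.\<close>
  have step: "tower_step (\<rho> x) (\<rho> (\<alpha> x))" if x: "x \<in> X" for x
  proof (cases "Suc (k' x) < length (W' x)")
    case True
    then show ?thesis using W'(5)[OF x True] E(1,2)[OF x] unfolding successively_conv_nth by (simp add: \<rho>_def)
  next
    case False
    then have top: "Suc (k' x) = length (W' x)" using W'(3)[OF x] by simp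
    have ax: "\<alpha> x \<in> X" using x by simp
    have "k' (\<alpha> x) = 0" using W'(6)[OF x top] W'(7)[OF ax] by simp
    then have "snd (\<rho> (\<alpha> x)) = 0"
      using E(2,4)[OF ax] W'(3)[OF ax] by (simp add: \<rho>_def hd_conv_nth flip: length_greater_0_conv)
    moreover have "\<rho> x = last (E (length (W' x)))"
    proof -
      have "E (length (W' x)) \<noteq> []" using E(2)[OF x] top by fastforce
      moreover have "length (E (length (W' x))) - 1 = k' x" using E(2)[OF x] top by linarith
      ultimately show ?thesis by (simp add: \<rho>_def last_conv_nth)
    qed
    ultimately show ?thesis using E(5)[OF x] by (simp add: tower_step_def)
  qed
  have "dist (s (\<alpha> x)) (\<beta> (s x)) < e" if x: "x \<in> X" for x
  proof -
    define y z where "y = s x" and "z = s (\<alpha> x)"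
    have "s ` X = Y" using s(1) by (simp add: homeomorphism_def)
    then have Y: "y \<in> Y" "z \<in> Y" unfolding y_def z_def using x A.in_X(1) by blast+
    then have Y: "y \<in> Y" "z \<in> Y" "\<beta> y \<in> Y" using B.in_X(1) by blast+
    have st: "tower_step (\<pi> y) (\<pi> z)" using step[OF x] s(2) x by (simp add: y_def z_def)
    have "dist z (\<beta> y) < e"
    \<comment> \<open>Below a top, \<open>z\<close> and \<open>\<beta> y\<close> have the same word
      and level, hence the same \<open>c\<close>; at a top, both lie in \<open>B0\<close>.\<close>
    proof (cases "Suc (k y) < length (W y)")
      case True
      then have "W z = W y" "k z = Suc (k y)" using st by (auto simp: tower_step_def \<pi>_def)
      with W(5)[OF Y(1) True] have "c z = c (\<beta> y)" using W(4)[OF Y(2)] W(4)[OF Y(3)] by simp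
      then show ?thesis using c(2) Y by blast
    next
      case False
      then have "k z = 0" using st by (auto simp: tower_step_def \<pi>_def)
      then have "z \<in> B0" using W(7)[OF Y(2)] by simp
      moreover have "\<beta> y \<in> B0" using W(6)[OF Y(1) top[OF Y(1) False]] .
      ultimately show ?thesis by (rule B0(4))
    qed
    then show ?thesis by (simp add: y_def z_def)
  qed
  with s(1) show ?thesis by (rule that)
qed

section \<open>Circle-valued cocycles\<close>

lemma norm_cis_minus_one_le: "cmod (cis t - 1) \<le> \<bar>t\<bar>"
proof -
  have "cmod (cis t - 1) = 2 * \<bar>sin (t / 2)\<bar>"
    using dist_exp_i_1[of t] by (simp add: cis_conv_exp)
  also have "\<dots> \<le> 2 * \<bar>t / 2\<bar>" using abs_sin_x_le_abs_x[of "t / 2"] by linarith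
  finally show ?thesis by simp
qed

lemma norm_prod_list_eq_1:
  fixes w :: "complex list"
  shows "(\<And>z. z \<in> set w \<Longrightarrow> cmod z = 1) \<Longrightarrow> cmod (prod_list w) = 1"
  by (induction w) (auto simp: norm_mult)

context cantor_minimal
begin

text \<open>The product of the cocycle along a column of height \<open>L\<close> differs from 1 by a rotation
  of angle at most \<open>pi\<close>, which is spread evenly over the \<open>L\<close> levels.\<close>

lemma approximate_coboundary:
  assumes cont: "continuous_on X \<zeta>" and unit: "\<And>x. x \<in> X \<Longrightarrow> cmod (\<zeta> x) = 1" and "e > 0"
  obtains \<eta> where "loc_const X \<eta>" "\<And>x. x \<in> X \<Longrightarrow> cmod (\<eta> x) = 1"
    "\<And>x. x \<in> X \<Longrightarrow> cmod (\<eta> (\<alpha> x) - \<zeta> x * \<eta> x) < e"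
proof -
  have "e / 2 > 0" using \<open>e > 0\<close> by simp
  then obtain d where d: "d > 0" "\<And>x y. x \<in> X \<Longrightarrow> y \<in> X \<Longrightarrow> dist x y < d \<Longrightarrow> dist (\<zeta> x) (\<zeta> y) < e / 2"
    using compact_uniformly_continuous[OF cont compact_X] unfolding uniformly_continuous_on_def by metis
  obtain c :: "'a \<Rightarrow> nat" where c: "loc_const X c" "\<And>x y. x \<in> X \<Longrightarrow> y \<in> X \<Longrightarrow> c x = c y \<Longrightarrow> dist x y < d"
    using cantor_set_fine_labels[OF cantor d(1)] by metis
  \<comment> \<open>The value of \<open>\<zeta>\<close> at a representative of each class of
    \<open>c\<close>: words of such values are locally constant, at the cost of an error below
    \<open>e / 2\<close>.\<close>
  define \<zeta>' where "\<zeta>' x = \<zeta> (inv_into X c (c x))" for x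
  have lc': "loc_const X \<zeta>'" unfolding \<zeta>'_def using c(1) by (rule loc_const_comp)
  have unit': "cmod (\<zeta>' x) = 1" if "x \<in> X" for x
    unfolding \<zeta>'_def using that by (intro unit inv_into_into) simp
  have near: "cmod (\<zeta>' x - \<zeta> x) < e / 2" if "x \<in> X" for x
  proof -
    have "inv_into X c (c x) \<in> X" "c (inv_into X c (c x)) = c x"
      using that by (simp_all add: inv_into_into f_inv_into_f)
    then show ?thesis using c(2) d(2) that by (simp add: \<zeta>'_def dist_norm)
  qed
  \<comment> \<open>Columns of height at least \<open>N\<close> bring \<open>pi\<close> divided by
    the height below the remaining \<open>e / 2\<close>.\<close>
  obtain N :: nat where N: "2 * pi / e < real N" using reals_Archimedean2 by blast
  have "loc_const X (\<lambda>x. x \<in> X)" by (rule loc_const_cong[THEN iffD1, OF _ loc_const_const[of X True]]) simp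
  then obtain C where C: "loc_const X (\<lambda>x. x \<in> C)" "C \<subseteq> X" "C \<noteq> {}"
    "\<And>x j. x \<in> C \<Longrightarrow> 0 < j \<Longrightarrow> j < N \<Longrightarrow> (\<alpha> ^^ j) x \<notin> C"
    using small_base[of X e N] X_nonempty \<open>e > 0\<close> by (metis order_refl)
  obtain W :: "'a \<Rightarrow> complex list" and k where W: "loc_const X W" "loc_const X k"
    "\<And>x. x \<in> X \<Longrightarrow> k x < length (W x)"
    "\<And>x. x \<in> X \<Longrightarrow> W x ! k x = \<zeta>' x"
    "\<And>x. x \<in> X \<Longrightarrow> Suc (k x) < length (W x) \<Longrightarrow> W (\<alpha> x) = W x \<and> k (\<alpha> x) = Suc (k x)"
    "\<And>x. x \<in> X \<Longrightarrow> Suc (k x) = length (W x) \<Longrightarrow> \<alpha> x \<in> C"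
    "\<And>x. x \<in> X \<Longrightarrow> k x = 0 \<longleftrightarrow> x \<in> C"
    "\<And>x j. x \<in> X \<Longrightarrow> j < length (W x) \<Longrightarrow> \<exists>y\<in>X. W y = W x \<and> k y = j"
    "\<And>x. x \<in> C \<Longrightarrow> (\<alpha> ^^ length (W x)) x \<in> C"
    using tower_words[OF C(1-3) lc'] by blast
  have unitW: "cmod z = 1" if "x \<in> X" "z \<in> set (W x)" for x z
  proof -
    obtain j where j: "j < length (W x)" "z = W x ! j" using \<open>z \<in> set (W x)\<close> by (metis in_set_conv_nth)
    obtain y where "y \<in> X" "W y = W x" "k y = j" using W(8)[OF \<open>x \<in> X\<close> j(1)] by blast
    then show ?thesis using W(4)[of y] unit'[of y] j(2) by simp
  qed
  have height: "length (W x) \<ge> N" "length (W x) > 0" if x: "x \<in> X" for x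
  proof -
    show pos: "length (W x) > 0" using W(3)[OF x] by linarith
    obtain y where y: "y \<in> X" "W y = W x" "k y = 0" using W(8)[OF x pos] by blast
    then have "y \<in> C" using W(7) by blast
    then have "(\<alpha> ^^ length (W x)) y \<in> C" using W(9)[of y] y by simp
    then show "length (W x) \<ge> N" using C(4)[OF \<open>y \<in> C\<close> pos] by linarith
  qed
  \<comment> \<open>For a word of unit numbers this is a root, of order its length, of the inverse
    of its product.\<close>
  define g where "g w = cis (- Arg (prod_list w) / real (length w))" for w :: "complex list"
  define \<eta> where "\<eta> x = g (W x) ^ k x * prod_list (take (k x) (W x))" for x
  have g1: "cmod (g w) = 1" for w by (simp add: g_def)
  have gclose: "cmod (g (W x) - 1) < e / 2" if x: "x \<in> X" for x
  proof -
    let ?L = "real (length (W x))"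
    have L: "?L > 0" "?L \<ge> real N" using height[OF x] by auto
    have "cmod (g (W x) - 1) \<le> \<bar>- Arg (prod_list (W x)) / ?L\<bar>"
      unfolding g_def by (rule norm_cis_minus_one_le)
    also have "\<dots> \<le> pi / ?L"
    proof -
      have "\<bar>Arg (prod_list (W x))\<bar> \<le> pi" using mpi_less_Arg[of "prod_list (W x)"] Arg_le_pi[of "prod_list (W x)"] by linarith
      then show ?thesis using L by (simp add: divide_right_mono abs_divide)
    qed
    also have "\<dots> < e / 2"
    proof -
      have "2 * pi / e < ?L" using N L by linarith
      then have "2 * pi < ?L * e" using \<open>e > 0\<close> by (simp add: divide_less_eq)
      then show ?thesis using L(1) by (simp add: divide_less_eq mult.commute)
    qed
    finally show ?thesis .
  qed
  have total: "g (W x) ^ length (W x) * prod_list (W x) = 1" if x: "x \<in> X" for x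
  proof -
    let ?P = "prod_list (W x)"
    have "cmod ?P = 1" using norm_prod_list_eq_1 unitW[OF x] by blast
    then have P: "?P = cis (Arg ?P)" using rcis_cmod_Arg[of ?P] by (simp add: rcis_def)
    have "g (W x) ^ length (W x) = cis (- Arg ?P)"
    proof -
      have "real (length (W x)) * (- Arg ?P / real (length (W x))) = - Arg ?P"
        using height(2)[OF x] by simp
      then show ?thesis by (simp only: g_def Complex.DeMoivre)
    qed
    then have "g (W x) ^ length (W x) * ?P = cis (- Arg ?P) * cis (Arg ?P)" using P by simp
    then show ?thesis by (simp add: cis_mult)
  qed
  have step: "\<eta> (\<alpha> x) = g (W x) * \<zeta>' x * \<eta> x" if x: "x \<in> X" for x
  proof -
    have "take (Suc (k x)) (W x) = take (k x) (W x) @ [\<zeta>' x]"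
      using W(3,4)[OF x] by (simp add: take_Suc_conv_app_nth)
    then have *: "g (W x) ^ Suc (k x) * prod_list (take (Suc (k x)) (W x)) = g (W x) * \<zeta>' x * \<eta> x"
      by (simp add: \<eta>_def)
    show ?thesis
    proof (cases "Suc (k x) < length (W x)")
      case True
      then show ?thesis using W(5)[OF x True] * by (simp add: \<eta>_def)
    next
      case False
      \<comment> \<open>At the top the corrected product has come back to 1 by \<open>total\<close>.
        This is the value of \<open>\<eta>\<close> at every base point, so the equation holds
        whichever column follows.\<close>
      then have top: "Suc (k x) = length (W x)" using W(3)[OF x] by simp
      have "k (\<alpha> x) = 0" using W(6)[OF x top] W(7)[of "\<alpha> x"] x by simp
      then show ?thesis using * total[OF x] unfolding top by (simp add: \<eta>_def)
    qed
  qed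
  have unit\<eta>: "cmod (\<eta> x) = 1" if "x \<in> X" for x
  proof -
    have "cmod (prod_list (take (k x) (W x))) = 1"
      using unitW[OF that] by (intro norm_prod_list_eq_1) (meson in_set_takeD)
    then show ?thesis by (simp add: \<eta>_def norm_mult norm_power g1)
  qed
  have "loc_const X \<eta>"
    unfolding \<eta>_def using loc_const_comp2[OF W(1,2), of "\<lambda>w j. g w ^ j * prod_list (take j w)"] .
  moreover have "cmod (\<eta> (\<alpha> x) - \<zeta> x * \<eta> x) < e" if x: "x \<in> X" for x
  proof -
    have "\<eta> (\<alpha> x) - \<zeta> x * \<eta> x = ((g (W x) - 1) * \<zeta>' x + (\<zeta>' x - \<zeta> x)) * \<eta> x"
      by (simp add: step[OF x] algebra_simps)
    then have "cmod (\<eta> (\<alpha> x) - \<zeta> x * \<eta> x) = cmod ((g (W x) - 1) * \<zeta>' x + (\<zeta>' x - \<zeta> x))"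
      using unit\<eta>[OF x] by (simp add: norm_mult)
    also have "\<dots> \<le> cmod ((g (W x) - 1) * \<zeta>' x) + cmod (\<zeta>' x - \<zeta> x)" by (rule norm_triangle_ineq)
    also have "cmod ((g (W x) - 1) * \<zeta>' x) = cmod (g (W x) - 1)" using unit'[OF x] by (simp add: norm_mult)
    finally show ?thesis using gclose[OF x] near[OF x] by linarith
  qed
  ultimately show ?thesis using unit\<eta> by (intro that)
qed

end

section \<open>Reflections of the circle\<close>

text \<open>Indexing by a truth value lets the choice of orientation in each fibre be a function
  satisfying \<open>loc_const\<close>.\<close>

definition reflect :: "bool \<Rightarrow> complex \<Rightarrow> complex" where
  "reflect b z = (if b then cnj z else z)"

lemma reflect_simps [simp]:
  "reflect b (reflect b z) = z" "reflect b 1 = 1" "cmod (reflect b z) = cmod z"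
  "reflect b (z * w) = reflect b z * reflect b w"
  by (auto simp: reflect_def)

lemma dist_reflect [simp]: "dist (reflect b z) (reflect b w) = dist z w"
  by (auto simp: reflect_def dist_norm simp flip: complex_cnj_diff)

text \<open>A reflection multiplies the imaginary part by a sign, and a locally constant sign is
  continuous.\<close>

lemma continuous_on_reflect:
  assumes "loc_const S b" "continuous_on S f"
  shows "continuous_on S (\<lambda>x. reflect (b x) (f x))"
proof -
  have "continuous_on S (\<lambda>x. if b x then -1 else 1 :: real)"
    using loc_const_comp[OF assms(1)] by (rule loc_const_imp_continuous_on)
  then have "continuous_on S (\<lambda>x. Complex (Re (f x)) ((if b x then -1 else 1) * Im (f x)))"
    using assms(2) by (intro continuous_intros)
  moreover have "Complex (Re (f x)) ((if b x then -1 else 1) * Im (f x)) = reflect (b x) (f x)" for x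
    by (auto simp: reflect_def complex_eq_iff)
  ultimately show ?thesis by simp
qed

lemma mem_circle: "z \<in> circle \<longleftrightarrow> cmod z = 1"
  by (simp add: circle_def)

text \<open>The coboundary trivialising \<open>orient \<phi>\<close> tells in which fibres the circle has to be reflected
  to turn \<open>\<phi>\<close> into a cocycle of rotations.\<close>

lemma (in cantor_minimal) rotation_normal_form:
  assumes \<phi>: "cont_isom_map X \<phi>" and op: "skew_orientation_preserving X \<alpha> \<phi>"
  obtains h u where "loc_const X h" "continuous_on X u" "\<And>x. x \<in> X \<Longrightarrow> cmod (u x) = 1"
    "\<And>x z. x \<in> X \<Longrightarrow> z \<in> circle \<Longrightarrow> \<phi> x z = reflect (h (\<alpha> x)) (u x * reflect (h x) z)"
proof -
  obtain f g :: "'a \<Rightarrow> int" where f: "continuous_on X f"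
    and fg: "\<And>x. x \<in> X \<Longrightarrow> orient \<phi> x = f x - f (\<alpha>' x) + 2 * g x"
    using op unfolding skew_orientation_preserving_def by blast
  \<comment> \<open>With the shift by \<open>\<alpha>'\<close>, the values of \<open>h\<close> at
    \<open>\<alpha> x\<close> and \<open>x\<close> are the parities of \<open>f x\<close> and
    \<open>f (\<alpha>' x)\<close>, which differ exactly when \<open>\<phi> x\<close> reverses
    orientation.\<close>
  define h where "h x = odd (f (\<alpha>' x))" for x
  \<comment> \<open>Reflections fix 1, so the straightened rotation can be read off from its effect
    on 1.\<close>
  define u where "u x = reflect (h (\<alpha> x)) (\<phi> x 1)" for x
  have lcf: "loc_const X f" using f by (rule continuous_on_imp_loc_const)
  have lch: "loc_const X h"
    unfolding h_def using loc_const_comp[OF loc_const_pow(2)[OF lcf, of 1], of odd] by simp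
  have "continuous_on X (\<lambda>x. \<phi> x 1)"
    unfolding continuous_on_iff
  proof (intro ballI allI impI)
    fix x and e :: real assume "x \<in> X" "0 < e"
    then show "\<exists>d>0. \<forall>x'\<in>X. dist x' x < d \<longrightarrow> dist (\<phi> x' 1) (\<phi> x 1) < e"
      using \<phi> unfolding cont_isom_map_def by (metis mem_circle norm_one)
  qed
  then have "continuous_on X u"
    unfolding u_def using loc_const_pow(1)[OF lch, of 1] by (intro continuous_on_reflect) simp_all
  moreover have "\<phi> x z = reflect (h (\<alpha> x)) (u x * reflect (h x) z) \<and> cmod (u x) = 1"
    if x: "x \<in> X" and z: "z \<in> circle" for x z
  proof (cases "orientation_preserving_isom (\<phi> x)")
    case True
    then obtain c where c: "cmod c = 1" "\<And>z. z \<in> circle \<Longrightarrow> \<phi> x z = c * z"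
      unfolding orientation_preserving_isom_def by blast
    have "f x - f (\<alpha>' x) + 2 * g x = 0" using fg[OF x] True by (simp add: orient_def)
    then have "h (\<alpha> x) = h x" using x unfolding h_def by simp presburger
    then show ?thesis using c z by (simp add: u_def mem_circle)
  next
    case False
    moreover have "\<phi> x \<in> isom_T" using \<phi> x by (simp add: cont_isom_map_def)
    ultimately obtain c where c: "cmod c = 1" "\<And>z. z \<in> circle \<Longrightarrow> \<phi> x z = c * cnj z"
      unfolding isom_T_def orientation_preserving_isom_def by blast
    have "f x - f (\<alpha>' x) + 2 * g x = 1" using fg[OF x] False by (simp add: orient_def)
    then have "h (\<alpha> x) = (\<not> h x)" using x unfolding h_def by simp presburger
    then show ?thesis using c z by (auto simp: u_def mem_circle reflect_def)
  qed
  moreover have "(1::complex) \<in> circle" by (simp add: mem_circle)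
  ultimately show ?thesis using lch by (intro that[of h u]) blast+
qed

text \<open>In circle coordinates straightened by \<open>h\<close> and \<open>k\<close> this is
  rotation by \<open>\<eta> x\<close> over \<open>s\<close>; the reflections translate it back to
  the original coordinates.\<close>

definition fibre_map ::
  "('a \<Rightarrow> 'b) \<Rightarrow> ('a \<Rightarrow> bool) \<Rightarrow> ('b \<Rightarrow> bool) \<Rightarrow> ('a \<Rightarrow> complex) \<Rightarrow> 'a \<times> complex \<Rightarrow> 'b \<times> complex" where
  "fibre_map s h k \<eta> = (\<lambda>(x, z). (s x, reflect (k (s x)) (\<eta> x * reflect (h x) z)))"

lemma continuous_on_fibre_map:
  assumes "continuous_on X s" "s \<in> X \<rightarrow> Y" "loc_const X h" "loc_const Y k" "continuous_on X \<eta>"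
  shows "continuous_on (X \<times> circle) (fibre_map s h k \<eta>)"
proof -
  have fst: "continuous_on (X \<times> circle) fst" "fst \<in> X \<times> circle \<rightarrow> X" by (auto intro: continuous_intros)
  have lch: "loc_const (X \<times> circle) (\<lambda>p. h (fst p))" using loc_const_compose[OF assms(3) fst] .
  have s: "continuous_on (X \<times> circle) (\<lambda>p. s (fst p))" "continuous_on (X \<times> circle) (\<lambda>p. \<eta> (fst p))"
    using assms(1,5) by (auto intro!: continuous_on_compose2[where f=fst] continuous_intros)
  have lck: "loc_const (X \<times> circle) (\<lambda>p. k (s (fst p)))"
    using assms(2) by (intro loc_const_compose[OF assms(4) s(1)]) auto
  have "continuous_on (X \<times> circle) (\<lambda>p. reflect (k (s (fst p))) (\<eta> (fst p) * reflect (h (fst p)) (snd p)))"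
    by (intro continuous_on_reflect lck lch continuous_intros s)
  with s(1) show ?thesis
    unfolding fibre_map_def split_def by (intro continuous_on_Pair)
qed

text \<open>The inverse has the same shape: reflections are involutions, and conjugation inverts a
  unit number.\<close>

lemma homeomorphism_fibre_map:
  assumes s: "homeomorphism X Y s s'" and h: "loc_const X h" and k: "loc_const Y k"
    and \<eta>: "continuous_on X \<eta>" "\<And>x. x \<in> X \<Longrightarrow> cmod (\<eta> x) = 1"
  shows "homeomorphism (X \<times> circle) (Y \<times> circle) (fibre_map s h k \<eta>)
           (fibre_map s' k h (\<lambda>y. cnj (\<eta> (s' y))))"
proof -
  have ss: "\<And>x. x \<in> X \<Longrightarrow> s' (s x) = x" "\<And>y. y \<in> Y \<Longrightarrow> s (s' y) = y" "s \<in> X \<rightarrow> Y" "s' \<in> Y \<rightarrow> X"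
    "continuous_on X s" "continuous_on Y s'"
    using s by (auto simp: homeomorphism_def)
  have unit: "cnj (\<eta> x) * \<eta> x = 1" "\<eta> x * cnj (\<eta> x) = 1" if "x \<in> X" for x
    using \<eta>(2)[OF that] by (metis complex_norm_square mult.commute of_real_1 one_power2)+
  have "continuous_on Y (\<lambda>y. \<eta> (s' y))" using ss by (intro continuous_on_compose2[OF \<eta>(1)]) auto
  then have c': "continuous_on Y (\<lambda>y. cnj (\<eta> (s' y)))" by (simp add: continuous_intros)
  show ?thesis
  proof (rule homeomorphismI)
    show "continuous_on (X \<times> circle) (fibre_map s h k \<eta>)"
      by (rule continuous_on_fibre_map[OF ss(5,3) h k \<eta>(1)])
    show "continuous_on (Y \<times> circle) (fibre_map s' k h (\<lambda>y. cnj (\<eta> (s' y))))"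
      by (rule continuous_on_fibre_map[OF ss(6,4) k h c'])
    show "fibre_map s h k \<eta> ` (X \<times> circle) \<subseteq> Y \<times> circle"
      using ss(3) \<eta>(2) by (auto simp: fibre_map_def mem_circle norm_mult)
    show "fibre_map s' k h (\<lambda>y. cnj (\<eta> (s' y))) ` (Y \<times> circle) \<subseteq> X \<times> circle"
      using ss(4) \<eta>(2) by (auto simp: fibre_map_def mem_circle norm_mult Pi_iff)
    show "fibre_map s' k h (\<lambda>y. cnj (\<eta> (s' y))) (fibre_map s h k \<eta> p) = p"
      if "p \<in> X \<times> circle" for p
      using that unit ss(1) by (auto simp: fibre_map_def simp del: reflect_simps(4) simp flip: mult.assoc)
    show "fibre_map s h k \<eta> (fibre_map s' k h (\<lambda>y. cnj (\<eta> (s' y))) q) = q"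
      if "q \<in> Y \<times> circle" for q
      using that unit ss(2,4) by (auto simp: fibre_map_def Pi_iff simp del: reflect_simps(4) simp flip: mult.assoc)
  qed
qed

section \<open>Approximate conjugacy of the skew products\<close>

text \<open>One \<open>n\<close> whose error is below the constancy radius of \<open>q\<close>
  suffices: read through \<open>\<sigma> n\<close>, the phase of \<open>Y\<close> still advances by
  one under \<open>skew \<alpha> \<phi>\<close>.\<close>

lemma periodic_spectrum_subset:
  assumes "cantor_minimal_system X \<alpha>" "cantor_minimal_system Y \<beta>" and \<phi>: "cont_isom_map X \<phi>"
    and \<sigma>: "\<And>n. homeomorphism (X \<times> circle) (Y \<times> circle) (\<sigma> n) (\<sigma>' n)"
    and lim: "unif_conv_on (Y \<times> circle) (\<lambda>n. \<sigma> n \<circ> skew \<alpha> \<phi> \<circ> \<sigma>' n) (skew \<beta> \<psi>)"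
  shows "periodic_spectrum Y \<beta> \<subseteq> periodic_spectrum X \<alpha>"
proof
  interpret A: cantor_minimal X \<alpha> by standard fact
  interpret B: cantor_minimal Y \<beta> by standard fact
  fix p assume "p \<in> periodic_spectrum Y \<beta>"
  then obtain q :: "'b \<Rightarrow> nat" where p: "p > 0" and q: "loc_const Y q"
    "\<And>y. y \<in> Y \<Longrightarrow> q (\<beta> y) mod p = Suc (q y) mod p"
    using B.periodic_spectrum_iff by blast
  obtain d where d: "d > 0" "\<And>x y. x \<in> Y \<Longrightarrow> y \<in> Y \<Longrightarrow> dist x y < d \<Longrightarrow> q x = q y"
    using loc_const_uniform[OF B.compact_X q(1)] by metis
  have "\<forall>\<^sub>F n in sequentially. \<forall>z\<in>Y \<times> circle. dist ((\<sigma> n \<circ> skew \<alpha> \<phi> \<circ> \<sigma>' n) z) (skew \<beta> \<psi> z) < d"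
    using lim d(1) unfolding unif_conv_on_def by blast
  from eventually_happens'[OF sequentially_bot this]
  obtain n where n: "\<And>z. z \<in> Y \<times> circle \<Longrightarrow> dist ((\<sigma> n \<circ> skew \<alpha> \<phi> \<circ> \<sigma>' n) z) (skew \<beta> \<psi> z) < d"
    by blast
  have S: "\<And>v. v \<in> X \<times> circle \<Longrightarrow> \<sigma> n v \<in> Y \<times> circle" "\<And>v. v \<in> X \<times> circle \<Longrightarrow> \<sigma>' n (\<sigma> n v) = v"
    "continuous_on (X \<times> circle) (\<sigma> n)"
    using \<sigma>[of n] by (auto simp: homeomorphism_def)
  have one: "(1::complex) \<in> circle" by (simp add: mem_circle)
  have lc: "loc_const (X \<times> circle) (\<lambda>v. q (fst (\<sigma> n v)))"
    using S by (intro loc_const_compose[OF q(1)] continuous_intros) (auto simp: mem_Times_iff)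
  \<comment> \<open>The phase must not depend on the circle coordinate, because
    \<open>skew \<alpha> \<phi>\<close> sends \<open>(x, 1)\<close> to
    \<open>(\<alpha> x, \<phi> x 1)\<close> and in general not to
    \<open>(\<alpha> x, 1)\<close>.\<close>
  have const: "q (fst (\<sigma> n (x, z))) = q (fst (\<sigma> n (x, 1)))" if "x \<in> X" "z \<in> circle" for x z
  proof -
    have "connected circle" unfolding circle_def by (rule connected_sphere) simp
    moreover have "loc_const circle (\<lambda>z. q (fst (\<sigma> n (x, z))))"
      using that(1) by (intro loc_const_compose[OF lc] continuous_intros) auto
    ultimately show ?thesis using that(2) one by (rule loc_const_connected)
  qed
  define q' where "q' x = q (fst (\<sigma> n (x, 1)))" for x
  have "loc_const X q'"
    unfolding q'_def using one by (intro loc_const_compose[OF lc] continuous_intros) auto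
  moreover have "q' (\<alpha> x) mod p = Suc (q' x) mod p" if x: "x \<in> X" for x
  proof -
    define v where "v = \<sigma> n (x, 1)"
    have v: "v \<in> Y \<times> circle" "\<sigma>' n v = (x, 1)" unfolding v_def using S x one by auto
    have "\<phi> x \<in> isom_T" using \<phi> x by (simp add: cont_isom_map_def)
    then have \<phi>1: "\<phi> x 1 \<in> circle" using one by (auto simp: isom_T_def mem_circle norm_mult)
    define w where "w = (\<sigma> n \<circ> skew \<alpha> \<phi> \<circ> \<sigma>' n) v"
    have w: "w = \<sigma> n (\<alpha> x, \<phi> x 1)" using v(2) by (simp add: w_def skew_def)
    then have wY: "fst w \<in> Y" using S(1)[of "(\<alpha> x, \<phi> x 1)"] x \<phi>1 by (auto simp: mem_Times_iff)
    have "q' (\<alpha> x) = q (fst w)" using const[of "\<alpha> x" "\<phi> x 1"] x \<phi>1 by (simp add: q'_def w)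
    also have "\<dots> = q (\<beta> (fst v))"
    proof (rule d(2)[OF wY])
      show "\<beta> (fst v) \<in> Y" using v(1) by auto
      have "fst (skew \<beta> \<psi> v) = \<beta> (fst v)" by (simp add: skew_def split_def)
      then show "dist (fst w) (\<beta> (fst v)) < d"
        using n[OF v(1)] dist_fst_le[of w "skew \<beta> \<psi> v"] by (simp add: w_def)
    qed
    also have "\<dots> mod p = Suc (q (fst v)) mod p" using q(2)[of "fst v"] v(1) by auto
    finally show ?thesis by (simp add: q'_def v_def)
  qed
  ultimately show "p \<in> periodic_spectrum X \<alpha>" using p A.periodic_spectrum_iff by blast
qed

text \<open>After straightening, the fibres are rotated by \<open>u\<close> and by \<open>w\<close>.
  A map over \<open>s\<close> twisted by \<open>\<eta>\<close> intertwines these rotations up to the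
  error with which \<open>\<eta>\<close> solves the coboundary equation for the quotient
  \<open>\<zeta>\<close> of \<open>w \<circ> s\<close> by \<open>u\<close>.\<close>

lemma skew_approximate_conjugacy:
  fixes X :: "'a::metric_space set" and Y :: "'b::metric_space set"
  assumes "cantor_minimal_system X \<alpha>" "cantor_minimal_system Y \<beta>"
    and \<phi>: "cont_isom_map X \<phi>" and \<psi>: "cont_isom_map Y \<psi>"
    and op: "skew_orientation_preserving X \<alpha> \<phi>" "skew_orientation_preserving Y \<beta> \<psi>"
    and PS: "periodic_spectrum Y \<beta> \<subseteq> periodic_spectrum X \<alpha>" and "e > 0"
  shows "\<exists>\<sigma> \<sigma>'. homeomorphism (X \<times> circle) (Y \<times> circle) \<sigma> \<sigma>' \<and>
           (\<forall>v\<in>Y \<times> circle. dist ((\<sigma> \<circ> skew \<alpha> \<phi> \<circ> \<sigma>') v) (skew \<beta> \<psi> v) < e)"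
proof -
  interpret A: cantor_minimal X \<alpha> by standard fact
  interpret B: cantor_minimal Y \<beta> by standard fact
  obtain h u where h: "loc_const X h" and u: "continuous_on X u" "\<And>x. x \<in> X \<Longrightarrow> cmod (u x) = 1"
    and \<phi>_eq: "\<And>x z. x \<in> X \<Longrightarrow> z \<in> circle \<Longrightarrow> \<phi> x z = reflect (h (\<alpha> x)) (u x * reflect (h x) z)"
    using A.rotation_normal_form[OF \<phi> op(1)] by blast
  obtain k w where k: "loc_const Y k" and w: "continuous_on Y w" "\<And>y. y \<in> Y \<Longrightarrow> cmod (w y) = 1"
    and \<psi>_eq: "\<And>y z. y \<in> Y \<Longrightarrow> z \<in> circle \<Longrightarrow> \<psi> y z = reflect (k (\<beta> y)) (w y * reflect (k y) z)"
    using B.rotation_normal_form[OF \<psi> op(2)] by blast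
  \<comment> \<open>Closeness below \<open>d\<close> forces \<open>k\<close> to agree at
    \<open>s (\<alpha> x)\<close> and \<open>\<beta> (s x)\<close>; otherwise one fibre could be
    reflected against the other, and the circle coordinates would be far apart.\<close>
  obtain d where d: "d > 0" "\<And>x y. x \<in> Y \<Longrightarrow> y \<in> Y \<Longrightarrow> dist x y < d \<Longrightarrow> k x = k y"
    using loc_const_uniform[OF B.compact_X k] by metis
  have "min (e / 2) d > 0" using d(1) \<open>e > 0\<close> by simp
  then obtain s s' where s: "homeomorphism X Y s s'"
    and close: "\<And>x. x \<in> X \<Longrightarrow> dist (s (\<alpha> x)) (\<beta> (s x)) < min (e / 2) d"
    using approximate_conjugacy[OF assms(1,2) PS] by metis
  have sX: "\<And>x. x \<in> X \<Longrightarrow> s x \<in> Y" "\<And>y. y \<in> Y \<Longrightarrow> s' y \<in> X" "\<And>y. y \<in> Y \<Longrightarrow> s (s' y) = y" "continuous_on X s"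
    using s by (auto simp: homeomorphism_def)
  define \<zeta> where "\<zeta> x = w (s x) * cnj (u x)" for x
  have "continuous_on X (\<lambda>x. w (s x))" using sX by (intro continuous_on_compose2[OF w(1)]) auto
  then have "continuous_on X \<zeta>" unfolding \<zeta>_def using u(1) by (intro continuous_intros)
  moreover have "cmod (\<zeta> x) = 1" if "x \<in> X" for x
    using that u(2) w(2) sX(1) by (simp add: \<zeta>_def norm_mult)
  moreover have "e / 2 > 0" using \<open>e > 0\<close> by simp
  ultimately obtain \<eta> where \<eta>: "loc_const X \<eta>" "\<And>x. x \<in> X \<Longrightarrow> cmod (\<eta> x) = 1"
    "\<And>x. x \<in> X \<Longrightarrow> cmod (\<eta> (\<alpha> x) - \<zeta> x * \<eta> x) < e / 2"
    using A.approximate_coboundary by metis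
  define \<sigma> where "\<sigma> = fibre_map s h k \<eta>"
  define \<sigma>' where "\<sigma>' = fibre_map s' k h (\<lambda>y. cnj (\<eta> (s' y)))"
  have "homeomorphism (X \<times> circle) (Y \<times> circle) \<sigma> \<sigma>'"
    unfolding \<sigma>_def \<sigma>'_def using \<eta> by (intro homeomorphism_fibre_map s h k loc_const_imp_continuous_on)
  moreover have "dist ((\<sigma> \<circ> skew \<alpha> \<phi> \<circ> \<sigma>') v) (skew \<beta> \<psi> v) < e" if "v \<in> Y \<times> circle" for v
  proof -
    obtain y z where v: "v = (y, z)" "y \<in> Y" "z \<in> circle" using \<open>v \<in> Y \<times> circle\<close> by auto
    define x where "x = s' y"
    have x: "x \<in> X" "s x = y" "\<alpha> x \<in> X" using sX v(2) by (simp_all add: x_def)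
    define t where "t = cnj (\<eta> x) * reflect (k y) z"
    have t: "reflect (h x) t \<in> circle" "cmod t = 1" using \<eta>(2)[OF x(1)] v(3) by (simp_all add: t_def mem_circle norm_mult)
    have "\<sigma>' v = (x, reflect (h x) t)" by (simp add: \<sigma>'_def fibre_map_def v x_def t_def)
    then have "(skew \<alpha> \<phi> \<circ> \<sigma>') v = (\<alpha> x, reflect (h (\<alpha> x)) (u x * t))"
      using \<phi>_eq[OF x(1) t(1)] by (simp add: skew_def)
    then have 1: "(\<sigma> \<circ> skew \<alpha> \<phi> \<circ> \<sigma>') v = (s (\<alpha> x), reflect (k (s (\<alpha> x))) (\<eta> (\<alpha> x) * (u x * t)))"
      by (simp add: \<sigma>_def fibre_map_def)
    have 2: "skew \<beta> \<psi> v = (\<beta> y, reflect (k (\<beta> y)) (w y * reflect (k y) z))"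
      using \<psi>_eq[OF v(2,3)] by (simp add: skew_def v)
    have near: "dist (s (\<alpha> x)) (\<beta> y) < e / 2" "k (s (\<alpha> x)) = k (\<beta> y)"
      using close[OF x(1)] d(2)[of "s (\<alpha> x)" "\<beta> y"] x sX(1) v(2) by auto
    \<comment> \<open>The factors \<open>cnj (u x)\<close> from \<open>\<zeta>\<close> and
      \<open>cnj (\<eta> x)\<close> from \<open>t\<close> cancel, so the fibre error is exactly that
      of the coboundary equation.\<close>
    have "w y * reflect (k y) z = \<zeta> x * \<eta> x * (u x * t)"
    proof -
      have "u x * cnj (u x) = 1" "\<eta> x * cnj (\<eta> x) = 1"
        using u(2)[OF x(1)] \<eta>(2)[OF x(1)] by (simp_all flip: complex_norm_square)
      moreover have "\<zeta> x * \<eta> x * (u x * t) = w y * (u x * cnj (u x)) * (\<eta> x * cnj (\<eta> x)) * reflect (k y) z"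
        by (simp add: \<zeta>_def t_def x(2) mult_ac)
      ultimately show ?thesis by simp
    qed
    then have "dist (\<eta> (\<alpha> x) * (u x * t)) (w y * reflect (k y) z) = cmod ((\<eta> (\<alpha> x) - \<zeta> x * \<eta> x) * (u x * t))"
      by (simp add: dist_norm algebra_simps)
    also have "\<dots> < e / 2" using \<eta>(3)[OF x(1)] u(2)[OF x(1)] t(2) by (simp add: norm_mult)
    finally have fib: "dist (\<eta> (\<alpha> x) * (u x * t)) (w y * reflect (k y) z) < e / 2" .
    have "dist ((\<sigma> \<circ> skew \<alpha> \<phi> \<circ> \<sigma>') v) (skew \<beta> \<psi> v)
        = sqrt ((dist (s (\<alpha> x)) (\<beta> y))\<^sup>2 + (dist (\<eta> (\<alpha> x) * (u x * t)) (w y * reflect (k y) z))\<^sup>2)"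
      unfolding 1 2 dist_Pair_Pair near(2) dist_reflect ..
    \<comment> \<open>Half of \<open>e\<close> is spent on the base, half on the fibre.\<close>
    also have "\<dots> \<le> dist (s (\<alpha> x)) (\<beta> y) + dist (\<eta> (\<alpha> x) * (u x * t)) (w y * reflect (k y) z)"
      by (rule sqrt_sum_squares_le_sum) simp_all
    finally show ?thesis using near(1) fib by linarith
  qed
  ultimately show ?thesis by blast
qed

theorem theorem4p4:
  fixes X :: "'a::metric_space set" and \<alpha> :: "'a \<Rightarrow> 'a"
    and Y :: "'b::metric_space set" and \<beta> :: "'b \<Rightarrow> 'b"
    and \<phi> :: "'a \<Rightarrow> complex \<Rightarrow> complex" and \<psi> :: "'b \<Rightarrow> complex \<Rightarrow> complex"
  assumes "cantor_minimal_system X \<alpha>" and "cantor_minimal_system Y \<beta>"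
    and "cont_isom_map X \<phi>" and "cont_isom_map Y \<psi>"
    and "skew_orientation_preserving X \<alpha> \<phi>" and "skew_orientation_preserving Y \<beta> \<psi>"
  shows "(\<exists>\<sigma> \<sigma>'. (\<forall>n. homeomorphism (X \<times> circle) (Y \<times> circle) (\<sigma> n) (\<sigma>' n)) \<and>
            unif_conv_on (Y \<times> circle) (\<lambda>n. \<sigma> n \<circ> skew \<alpha> \<phi> \<circ> \<sigma>' n) (skew \<beta> \<psi>))
         \<longleftrightarrow> periodic_spectrum Y \<beta> \<subseteq> periodic_spectrum X \<alpha>"
proof
  assume "\<exists>\<sigma> \<sigma>'. (\<forall>n. homeomorphism (X \<times> circle) (Y \<times> circle) (\<sigma> n) (\<sigma>' n)) \<and>
            unif_conv_on (Y \<times> circle) (\<lambda>n. \<sigma> n \<circ> skew \<alpha> \<phi> \<circ> \<sigma>' n) (skew \<beta> \<psi>)"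
  then show "periodic_spectrum Y \<beta> \<subseteq> periodic_spectrum X \<alpha>"
    using periodic_spectrum_subset[OF assms(1-3)] by blast
next
  assume PS: "periodic_spectrum Y \<beta> \<subseteq> periodic_spectrum X \<alpha>"
  have "\<exists>\<sigma> \<sigma>'. homeomorphism (X \<times> circle) (Y \<times> circle) \<sigma> \<sigma>' \<and>
           (\<forall>v\<in>Y \<times> circle. dist ((\<sigma> \<circ> skew \<alpha> \<phi> \<circ> \<sigma>') v) (skew \<beta> \<psi> v) < 1 / real (Suc n))" for n
    by (rule skew_approximate_conjugacy[OF assms PS]) simp
  then obtain \<sigma> \<sigma>' where \<sigma>: "\<And>n. homeomorphism (X \<times> circle) (Y \<times> circle) (\<sigma> n) (\<sigma>' n)"
    "\<And>n v. v \<in> Y \<times> circle \<Longrightarrow> dist ((\<sigma> n \<circ> skew \<alpha> \<phi> \<circ> \<sigma>' n) v) (skew \<beta> \<psi> v) < 1 / real (Suc n)"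
    by metis
  have "unif_conv_on (Y \<times> circle) (\<lambda>n. \<sigma> n \<circ> skew \<alpha> \<phi> \<circ> \<sigma>' n) (skew \<beta> \<psi>)"
    unfolding unif_conv_on_def
  proof (intro allI impI)
    fix e :: real assume "e > 0"
    then obtain N where N: "1 / real (Suc N) < e" using nat_approx_posE by blast
    show "\<forall>\<^sub>F n in sequentially. \<forall>v\<in>Y \<times> circle. dist ((\<sigma> n \<circ> skew \<alpha> \<phi> \<circ> \<sigma>' n) v) (skew \<beta> \<psi> v) < e"
      unfolding eventually_sequentially
    proof (intro exI allI impI ballI)
      fix n v assume "N \<le> n" "v \<in> Y \<times> circle"
      have "1 / real (Suc n) \<le> 1 / real (Suc N)" using \<open>N \<le> n\<close> by (simp add: frac_le)
      with \<sigma>(2)[OF \<open>v \<in> Y \<times> circle\<close>, of n] N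
      show "dist ((\<sigma> n \<circ> skew \<alpha> \<phi> \<circ> \<sigma>' n) v) (skew \<beta> \<psi> v) < e" by linarith
    qed
  qed
  with \<sigma>(1) show "\<exists>\<sigma> \<sigma>'. (\<forall>n. homeomorphism (X \<times> circle) (Y \<times> circle) (\<sigma> n) (\<sigma>' n)) \<and>
            unif_conv_on (Y \<times> circle) (\<lambda>n. \<sigma> n \<circ> skew \<alpha> \<phi> \<circ> \<sigma>' n) (skew \<beta> \<psi>)" by blast
qed

end
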